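(* For every $\epsilon>0$ there exist a constant $c>0$ and, for infinitely many $n$, a simple undirected unweighted graph $G$ on $n$ nodes together with an initial coloring of its nodes with two colors, such that the stabilization time of the minority process on $G$ is at least $c\,n^{2-\epsilon}$ (i.e., $\Omega(n^{2-\epsilon})$) in each of the following models: (B) sequential benevolent, (C) independent benevolent, (D) free benevolent, (E) concurrent synchronous, (F) sequential random, and (G) concurrent random; in the randomized models this holds for every possible execution.
   Context: Let $G$ be a simple, unweighted, undirected graph whose nodes are colored with two colors (black and white). A node $v$ is switchable in the current coloring if, with $v$ currently colored $c_1$, the other color $c_2$ occurs strictly fewer times than $c_1$ among the neighbors of $v$; switching $v$ means changing its color to the color least frequent in its neighborhood (with two colors: to the other color). The minority process is a sequence of steps, each step consisting of a set of nodes that switch simultaneously; a step is valid only if every chosen node is switchable in the coloring before the step. A coloring is stable if no node is switchable, and the stabilization time is the number of steps until a stable coloring is reached. Models: (B) sequential benevolent: each step switches exactly one switchable node, chosen by a benevolent player who minimizes the number of steps until stabilization; (C) independent benevolent: in each step the benevolent player chooses any independent set of switchable nodes and switches them simultaneously; (D) free benevolent: in each step the benevolent player chooses any set of switchable nodes and switches them simultaneously; (E) concurrent synchronous: in each step all switchable nodes switch simultaneously; (F) sequential random: in each step exactly one node switches, chosen uniformly at random among the switchable nodes; (G) concurrent random: in each step every switchable node switches independently with some fixed probability $p$. *)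

theory Defs
  imports "HOL-Probability.Probability" "Graph_Theory.Pair_Digraph"
begin

text \<open>
  A simple undirected graph is a \<open>pair_graph\<close>: a finite, loop-free digraph without
  parallel arcs whose arc relation is symmetric, so that an edge between \<open>u\<close> and \<open>v\<close>
  is represented by the two arcs \<open>(u, v)\<close> and \<open>(v, u)\<close>.
\<close>

datatype color = Black | White

fun opposite :: "color \<Rightarrow> color" where
  "opposite Black = White"
| "opposite White = Black"

text \<open>The values of a coloring outside the vertex set are irrelevant and never change.\<close>

type_synonym 'a coloring = "'a \<Rightarrow> color"

definition neighbors :: "'a pair_pre_digraph \<Rightarrow> 'a \<Rightarrow> 'a set" where
  "neighbors G v = {w. (v, w) \<in> parcs G}"

definition switchable :: "'a pair_pre_digraph \<Rightarrow> 'a coloring \<Rightarrow> 'a set" where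
  "switchable G col = {v \<in> pverts G.
     card {w \<in> neighbors G v. col w = opposite (col v)} < card {w \<in> neighbors G v. col w = col v}}"

definition stable_coloring :: "'a pair_pre_digraph \<Rightarrow> 'a coloring \<Rightarrow> bool" where
  "stable_coloring G col \<longleftrightarrow> switchable G col = {}"

definition switch :: "'a set \<Rightarrow> 'a coloring \<Rightarrow> 'a coloring" where
  "switch S col = (\<lambda>v. if v \<in> S then opposite (col v) else col v)"

definition independent_set :: "'a pair_pre_digraph \<Rightarrow> 'a set \<Rightarrow> bool" where
  "independent_set G S \<longleftrightarrow> S \<subseteq> pverts G \<and> (\<forall>u\<in>S. \<forall>v\<in>S. (u, v) \<notin> parcs G)"

text \<open>
  A rule assigns to every coloring the family of node sets that may be switched
  simultaneously in the next step.  An execution is the infinite sequence of colorings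
  visited, which stays constant as soon as a stable coloring has been reached.
\<close>

type_synonym 'a rule = "'a coloring \<Rightarrow> 'a set set"

definition execution ::
    "'a pair_pre_digraph \<Rightarrow> 'a rule \<Rightarrow> 'a coloring \<Rightarrow> (nat \<Rightarrow> 'a coloring) \<Rightarrow> bool" where
  "execution G R col X \<longleftrightarrow> X 0 = col \<and>
     (\<forall>t. if stable_coloring G (X t) then X (Suc t) = X t
          else \<exists>S \<in> R (X t). X (Suc t) = switch S (X t))"

text \<open>The infimum of the empty set is \<open>\<infinity>\<close>: the time of an execution that never stabilizes.\<close>

definition stabilization_time :: "'a pair_pre_digraph \<Rightarrow> (nat \<Rightarrow> 'a coloring) \<Rightarrow> enat" where
  "stabilization_time G X = (INF t \<in> {t. stable_coloring G (X t)}. enat t)"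

text \<open>In the benevolent models the player minimizes over all executions obeying the rule.\<close>

definition benevolent_time :: "'a pair_pre_digraph \<Rightarrow> 'a rule \<Rightarrow> 'a coloring \<Rightarrow> enat" where
  "benevolent_time G R col = (INF X \<in> {X. execution G R col X}. stabilization_time G X)"

definition sequential_rule :: "'a pair_pre_digraph \<Rightarrow> 'a rule" where
  "sequential_rule G col = {{v} | v. v \<in> switchable G col}"

definition independent_rule :: "'a pair_pre_digraph \<Rightarrow> 'a rule" where
  "independent_rule G col = {S. S \<subseteq> switchable G col \<and> independent_set G S}"

definition free_rule :: "'a pair_pre_digraph \<Rightarrow> 'a rule" where
  "free_rule G col = {S. S \<subseteq> switchable G col}"

definition synchronous_execution ::
    "'a pair_pre_digraph \<Rightarrow> 'a coloring \<Rightarrow> nat \<Rightarrow> 'a coloring" where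
  "synchronous_execution G col t = ((\<lambda>col'. switch (switchable G col') col') ^^ t) col"

text \<open>
  In the randomized models the set switched in the next step is drawn from a distribution
  depending on the current coloring.  The possible executions are those in which every step
  has positive probability.  The distribution of the sequential model is meaningful only for
  colorings that are not stable, and \<open>execution\<close> consults it only for these.
\<close>

definition sequential_random_step ::
    "'a pair_pre_digraph \<Rightarrow> 'a coloring \<Rightarrow> 'a set pmf" where
  "sequential_random_step G col = map_pmf (\<lambda>v. {v}) (pmf_of_set (switchable G col))"

definition concurrent_random_step ::
    "real \<Rightarrow> 'a pair_pre_digraph \<Rightarrow> 'a coloring \<Rightarrow> 'a set pmf" where
  "concurrent_random_step p G col =
     map_pmf (\<lambda>f. {v \<in> switchable G col. f v})
       (Pi_pmf (switchable G col) False (\<lambda>_. bernoulli_pmf p))"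

definition possible_execution ::
    "'a pair_pre_digraph \<Rightarrow> ('a coloring \<Rightarrow> 'a set pmf) \<Rightarrow> 'a coloring \<Rightarrow>
     (nat \<Rightarrow> 'a coloring) \<Rightarrow> bool" where
  "possible_execution G step col X \<longleftrightarrow> execution G (\<lambda>col'. set_pmf (step col')) col X"

end

theory Submission
  imports Defs
begin

text \<open>
  The graph is a cascade of \<open>K\<close> levels.  Each level has three tracks: long paths that flip one
  node at a time, as a domain wall driven by an external field.  The field on track \<open>j\<close> of a
  level comes from drives, paths of about \<open>3^(K - k)\<close> nodes, each of which is adjacent to
  half of a track of the level above and to half of track \<open>j\<close>.  Whenever track \<open>i\<close> of the level
  above has flipped, drive \<open>(i, j)\<close> is pulled almost equally strongly by its two tracks, flips as a
  domain wall itself and thereby reverses the field on track \<open>j\<close>.  In this round the three tracks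
  of the level flip once each, so the flips of a level are three times as frequent as those of the
  level above, while the drives get three times smaller: the energy of a flip is split into three.
  Gates and relays make level \<open>k\<close> wait until the round of level \<open>k + 1\<close> is complete.  All forces are
  balanced up to a constant, so that in every reachable coloring exactly one node is switchable;
  hence all models run through the same sequence of switches.  There are \<open>O(K 3^K)\<close> nodes, and
  level \<open>K\<close> alone makes more than \<open>9^K\<close> switches.
\<close>

text \<open>
  \<open>Track k j t\<close> and \<open>Drive k i j t\<close> are the \<open>t\<close>-th nodes of their paths, where \<open>i\<close> is the index of
  the track at level \<open>k - 1\<close> that powers the drive.  Level \<open>0\<close> consists only of \<open>Track 0 0 t\<close>, a
  complete bipartite graph that never switches and acts as a track that has just flipped.
\<close>

datatype vertex = Track nat nat nat | Drive nat nat nat nat | Gate nat nat | Relay nat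

section \<open>Signed sums over one half of a path\<close>

definition flip_sign :: "bool \<Rightarrow> int" where "flip_sign b = (if b then -1 else 1)"

text \<open>The positions of parity different from that of \<open>a\<close>. This relation between
  \<open>u\<close> and \<open>a\<close> is symmetric, as adjacency has to be.\<close>

definition parity_class :: "nat \<Rightarrow> nat \<Rightarrow> nat set" where
  "parity_class n a = {u. u < 2 * n \<and> odd (u + a)}"

text \<open>Up to a common sign, the force exerted by half of a path whose domain wall stands at
  \<open>\<tau>\<close>.\<close>

definition class_sum :: "nat \<Rightarrow> nat \<Rightarrow> nat \<Rightarrow> int" where
  "class_sum n a \<tau> = (\<Sum>u\<in>parity_class n a. flip_sign (u < \<tau>))"

lemma finite_parity_class [simp]: "finite (parity_class n a)"
  by (simp add: parity_class_def)

lemma card_parity_class: "card (parity_class n a) = n"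
proof (induction n)
  case 0
  show ?case by (simp add: parity_class_def)
next
  case (Suc n)
  have "parity_class (Suc n) a
      = insert (if even a then 2 * n + 1 else 2 * n) (parity_class n a)"
    by (auto simp: parity_class_def less_Suc_eq)
  moreover have "(if even a then 2 * n + 1 else 2 * n) \<notin> parity_class n a"
    by (auto simp: parity_class_def)
  ultimately show ?case
    using Suc by simp
qed

lemma class_sum_0: "class_sum n a 0 = int n"
  by (simp add: class_sum_def flip_sign_def card_parity_class)

lemma class_sum_full:
  assumes "2 * n \<le> \<tau>"
  shows "class_sum n a \<tau> = - int n"
proof -
  have "class_sum n a \<tau> = (\<Sum>u\<in>parity_class n a. -1)"
    unfolding class_sum_def using assms
    by (intro sum.cong) (auto simp: flip_sign_def parity_class_def)
  then show ?thesis
    by (simp add: card_parity_class)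
qed

lemma class_sum_le: "class_sum n a \<tau> \<le> int n"
  using sum_bounded_above[of "parity_class n a" "\<lambda>u. flip_sign (u < \<tau>)" 1]
  by (simp add: class_sum_def card_parity_class flip_sign_def)

lemma class_sum_ge: "- int n \<le> class_sum n a \<tau>"
  using sum_bounded_below[of "parity_class n a" "-1" "\<lambda>u. flip_sign (u < \<tau>)"]
  by (simp add: class_sum_def card_parity_class flip_sign_def)

text \<open>For even \<open>a\<close> the class contains the position that the wall passes last. An
  unfinished path thus misses its full force by at least 2, which makes the first node of the path
  that it drives wait for its completion.\<close>

lemma class_sum_ge_last:
  assumes "\<tau> < 2 * n" "even a"
  shows "- int n + 2 \<le> class_sum n a \<tau>"
proof -
  let ?l = "2 * n - 1"
  have l: "?l \<in> parity_class n a"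
    using assms by (auto simp: parity_class_def)
  have "class_sum n a \<tau> = flip_sign (?l < \<tau>) + (\<Sum>u\<in>parity_class n a - {?l}. flip_sign (u < \<tau>))"
    unfolding class_sum_def using l by (simp add: sum.remove)
  moreover have "flip_sign (?l < \<tau>) = 1"
    using assms by (auto simp: flip_sign_def)
  moreover have "(\<Sum>u\<in>parity_class n a - {?l}. flip_sign (u < \<tau>)) \<ge> - (int n - 1)"
    using sum_bounded_below[of "parity_class n a - {?l}" "-1" "\<lambda>u. flip_sign (u < \<tau>)"] l assms
    by (simp add: card_parity_class flip_sign_def of_nat_diff)
  ultimately show ?thesis
    by simp
qed

locale relay_graph =
  fixes K :: nat
  assumes K_pos: "0 < K"
begin

text \<open>\<open>s k\<close> and \<open>g k\<close> are half the numbers of nodes of a drive and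
  of a track, hence the sizes of their parity classes. \<open>M k\<close> counts the nodes of a
  drive and a track together.\<close>

definition s :: "nat \<Rightarrow> nat" where "s k = 3 ^ (K + 1 - k) - 1"
definition g :: "nat \<Rightarrow> nat" where "g k = 3 ^ (K + 1) + 2 * (K - k)"
definition M :: "nat \<Rightarrow> nat" where "M k = 2 * s k + 2 * g k"
text \<open>One round per track of the level above; level \<open>0\<close> has a single
  track.\<close>

definition rounds :: "nat \<Rightarrow> nat" where "rounds k = (if k = 1 then 1 else 3)"

text \<open>The recurrences for \<open>s\<close> and \<open>g\<close> are the force balances on the nodes of tracks and of drives.\<close>

lemma s_rec:
  assumes "k \<le> K"
  shows "s k = 3 * s (Suc k) + 2"
proof -
  have "(3::nat) ^ (K + 1 - k) = 3 * 3 ^ (K + 1 - Suc k)"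
    using assms by (simp add: Suc_diff_le)
  moreover have "(1::nat) \<le> 3 ^ (K + 1 - Suc k)"
    by simp
  ultimately show ?thesis
    unfolding s_def by linarith
qed

lemma s_pos: "k \<le> K \<Longrightarrow> 2 \<le> s k"
  using s_rec by simp

lemma s_Suc_K [simp]: "s (Suc K) = 0"
  by (simp add: s_def)

lemma g_rec: "1 \<le> k \<Longrightarrow> k \<le> K \<Longrightarrow> g (k - 1) = g k + 2"
  by (simp add: g_def)

lemma g_pos: "0 < g k"
  by (simp add: g_def)

text \<open>Freezes level \<open>0\<close>: a node there has \<open>g 0\<close> neighbors of the
  other color on its own track, and its drives pull with at most \<open>3 * s 1\<close>.\<close>

lemma g_0_ge: "3 * s 1 \<le> g 0"
  by (simp add: s_def g_def)

definition vertices :: "vertex set" where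
  "vertices = {Track k j t | k j t. k \<le> K \<and> (if k = 0 then j = 0 else j < 3) \<and> t < 2 * g k}
     \<union> {Drive k i j t | k i j t. 1 \<le> k \<and> k \<le> K \<and> i < rounds k \<and> j < 3 \<and> t < 2 * s k}
     \<union> {Gate k j | k j. 1 \<le> k \<and> k \<le> K \<and> j < 3}
     \<union> {Relay k | k. 1 \<le> k \<and> k \<le> K}"

text \<open>A drive meets the upper track at a parity shifted by \<open>j\<close>, but the lower one
  without a shift by \<open>i\<close>, so drives with consecutive \<open>i\<close> push their track
  in opposite directions. \<open>Gate k j\<close> hears the ends of track \<open>j\<close> and of
  its drives and, for \<open>j < 2\<close>, holds the first nodes of the next drives.
  \<open>Relay k\<close> links the last gate of level \<open>k\<close> to all gates of level
  \<open>k - 1\<close>.\<close>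

fun nb :: "vertex \<Rightarrow> vertex set" where
  "nb (Track k j t) =
     (if k = 0 then Track 0 0 ` parity_class (g 0) t
      else Track k j ` {u. u < 2 * g k \<and> (u = t + 1 \<or> t = u + 1)}
        \<union> (\<lambda>(i, u). Drive k i j u) ` ({..<rounds k} \<times> parity_class (s k) t)
        \<union> (if t = 2 * g k - 1 then {Gate k j} else {}))
     \<union> (\<lambda>(i, u). Drive (Suc k) j i u) ` (SIGMA i:{..<3}. parity_class (s (Suc k)) (t + i))"
| "nb (Drive k i j t) =
     Track (k - 1) i ` parity_class (g (k - 1)) (t + j)
     \<union> Track k j ` parity_class (g k) t
     \<union> Drive k i j ` {u. u < 2 * s k \<and> (u = t + 1 \<or> t = u + 1)}
     \<union> (if t = 0 \<and> j > 0 then {Gate k (j - 1)} else {})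
     \<union> (if t = 0 \<and> j = 2 then {Relay k} else {})
     \<union> (if t = 2 * s k - 1 then {Gate k j} else {})"
| "nb (Gate k j) =
     {Track k j (2 * g k - 1)}
     \<union> (\<lambda>i. Drive k i j (2 * s k - 1)) ` {..<rounds k}
     \<union> (if j < 2 then (\<lambda>i. Drive k i (j + 1) 0) ` {..<rounds k} else {Relay k})
     \<union> (if k < K then {Relay (Suc k)} else {})"
| "nb (Relay k) =
     {Gate k 2} \<union> (\<lambda>i. Drive k i 2 0) ` {..<rounds k}
     \<union> (if 1 < k then Gate (k - 1) ` {..<3} else {})"

lemma in_parity_class: "u \<in> parity_class n a \<longleftrightarrow> u < 2 * n \<and> odd (u + a)"
  by (simp add: parity_class_def)

lemma nb_Track_iff:
  "Track k' j' t' \<in> nb (Track k j t) \<longleftrightarrow> (if k = 0 then k' = 0 \<and> j' = 0 \<and> t' \<in> parity_class (g 0) t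
      else k' = k \<and> j' = j \<and> t' < 2 * g k \<and> (t' = t + 1 \<or> t = t' + 1))"
  "Drive k' i' j' t' \<in> nb (Track k j t) \<longleftrightarrow>
     (k \<noteq> 0 \<and> k' = k \<and> j' = j \<and> i' < rounds k \<and> t' \<in> parity_class (s k) t)
     \<or> (k' = Suc k \<and> i' = j \<and> j' < 3 \<and> t' \<in> parity_class (s (Suc k)) (t + j'))"
  "Gate k' j' \<in> nb (Track k j t) \<longleftrightarrow> k \<noteq> 0 \<and> k' = k \<and> j' = j \<and> t = 2 * g k - 1"
  "Relay k' \<notin> nb (Track k j t)"
  by (auto simp: image_iff)

lemma nb_Drive_iff:
  "Track k' j' t' \<in> nb (Drive k i j t) \<longleftrightarrow>
     (k' = k - 1 \<and> j' = i \<and> t' \<in> parity_class (g (k - 1)) (t + j))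
     \<or> (k' = k \<and> j' = j \<and> t' \<in> parity_class (g k) t)"
  "Drive k' i' j' t' \<in> nb (Drive k i j t) \<longleftrightarrow>
     k' = k \<and> i' = i \<and> j' = j \<and> t' < 2 * s k \<and> (t' = t + 1 \<or> t = t' + 1)"
  "Gate k' j' \<in> nb (Drive k i j t) \<longleftrightarrow>
     k' = k \<and> (t = 0 \<and> j = Suc j' \<or> t = 2 * s k - 1 \<and> j' = j)"
  "Relay k' \<in> nb (Drive k i j t) \<longleftrightarrow> k' = k \<and> t = 0 \<and> j = 2"
  by (auto simp: image_iff)

lemma nb_Gate_iff:
  "Track k' j' t' \<in> nb (Gate k j) \<longleftrightarrow> k' = k \<and> j' = j \<and> t' = 2 * g k - 1"
  "Drive k' i' j' t' \<in> nb (Gate k j) \<longleftrightarrow> k' = k \<and> i' < rounds k \<and>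
     (j' = j \<and> t' = 2 * s k - 1 \<or> j < 2 \<and> j' = Suc j \<and> t' = 0)"
  "Gate k' j' \<notin> nb (Gate k j)"
  "Relay k' \<in> nb (Gate k j) \<longleftrightarrow> (2 \<le> j \<and> k' = k \<or> k < K \<and> k' = Suc k)"
  by (auto simp: image_iff)

lemma nb_Relay_iff:
  "Track k' j' t' \<notin> nb (Relay k)"
  "Drive k' i' j' t' \<in> nb (Relay k) \<longleftrightarrow> k' = k \<and> i' < rounds k \<and> j' = 2 \<and> t' = 0"
  "Gate k' j' \<in> nb (Relay k) \<longleftrightarrow> (k' = k \<and> j' = 2 \<or> 1 < k \<and> k' = k - 1 \<and> j' < 3)"
  "Relay k' \<notin> nb (Relay k)"
  by (auto simp: image_iff)

lemmas nb_iffs = nb_Track_iff nb_Drive_iff nb_Gate_iff nb_Relay_iff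

lemma vertices_iff:
  "Track k j t \<in> vertices \<longleftrightarrow> k \<le> K \<and> (if k = 0 then j = 0 else j < 3) \<and> t < 2 * g k"
  "Drive k i j t \<in> vertices \<longleftrightarrow> 1 \<le> k \<and> k \<le> K \<and> i < rounds k \<and> j < 3 \<and> t < 2 * s k"
  "Gate k j \<in> vertices \<longleftrightarrow> 1 \<le> k \<and> k \<le> K \<and> j < 3"
  "Relay k \<in> vertices \<longleftrightarrow> 1 \<le> k \<and> k \<le> K"
  by (auto simp: vertices_def)

lemma nb_sub:
  assumes "v \<in> vertices" "u \<in> nb v"
  shows "u \<in> vertices"
proof -
  have s: "k \<le> K \<Longrightarrow> 0 < s k" for k
    using s_pos[of k] by simp
  \<comment> \<open>Below level \<open>K\<close> there are no drives, since
    \<open>s (Suc K) = 0\<close>.\<close>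
  have k0: "t' < 2 * s (Suc k) \<Longrightarrow> k \<le> K \<Longrightarrow> Suc k \<le> K" for t' k
    by (cases "k = K") auto
  have r: "k \<le> K \<Longrightarrow> i < rounds k \<Longrightarrow> i < 3" for k i
    by (simp add: rounds_def split: if_splits)
  show ?thesis
    using assms s g_pos
    by (cases v; cases u)
      (auto simp del: nb.simps simp: nb_iffs vertices_iff in_parity_class rounds_def
        dest: k0 r split: if_splits)
qed

lemma nb_sym:
  assumes "v \<in> vertices" "u \<in> nb v"
  shows "v \<in> nb u"
proof -
  have pred: "k - Suc 0 = Suc 0 \<longleftrightarrow> k = Suc (Suc 0)" for k
    by auto
  show ?thesis
    using assms nb_sub[OF assms]
    by (cases v; cases u)
      (auto simp del: nb.simps simp: nb_iffs vertices_iff in_parity_class rounds_def add_ac pred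
        split: if_splits)
qed

lemma nb_irrefl: "v \<in> vertices \<Longrightarrow> v \<notin> nb v"
  by (cases v) (auto simp del: nb.simps simp: nb_iffs in_parity_class)

end

section \<open>Signs and sums over neighborhoods\<close>

definition alt :: "nat \<Rightarrow> int" where "alt n = (if even n then 1 else -1)"

lemma alt_add: "alt (m + n) = alt m * alt n"
  by (simp add: alt_def)

lemma alt_mult_self [simp]: "alt n * alt n = 1" "alt n * (alt n * a) = a"
  by (simp_all add: alt_def)

lemma alt_of_bool: "alt (of_bool b) = flip_sign b"
  by (simp add: alt_def flip_sign_def)

text \<open>The alternating sign is constant on a parity class.\<close>

lemma alternating_class_sum:
  "(\<Sum>u\<in>parity_class n a. alt u * flip_sign (u < \<tau>)) = - alt a * class_sum n a \<tau>"
proof -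
  have "(\<Sum>u\<in>parity_class n a. alt u * flip_sign (u < \<tau>))
      = (\<Sum>u\<in>parity_class n a. - alt a * flip_sign (u < \<tau>))"
    by (rule sum.cong) (auto simp: parity_class_def alt_def)
  then show ?thesis
    by (simp only: class_sum_def sum_distrib_left)
qed

lemma path_sum:
  fixes f :: "nat \<Rightarrow> int"
  assumes "t < n"
  shows "(\<Sum>u | u < n \<and> (u = t + 1 \<or> t = u + 1). f u)
    = (if 0 < t then f (t - 1) else 0) + (if t + 1 < n then f (t + 1) else 0)"
proof -
  have "{u. u < n \<and> (u = t + 1 \<or> t = u + 1)}
      = (if 0 < t then {t - 1} else {}) \<union> (if t + 1 < n then {t + 1} else {})"
    using assms by auto
  then show ?thesis by simp
qed

context relay_graph
begin

text \<open>The neighborhood is a disjoint union of injective images. At the end of the path the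
  gate takes the place of the successor.\<close>

lemma sum_nb_Track:
  fixes f :: "vertex \<Rightarrow> int"
  assumes "0 < k" "t < 2 * g k"
  shows "sum f (nb (Track k j t)) =
    (\<Sum>i<rounds k. \<Sum>u\<in>parity_class (s k) t. f (Drive k i j u))
    + (\<Sum>i<3. \<Sum>u\<in>parity_class (s (Suc k)) (t + i). f (Drive (Suc k) j i u))
    + (if 0 < t then f (Track k j (t - 1)) else 0)
    + (if t + 1 < 2 * g k then f (Track k j (t + 1)) else f (Gate k j))"
proof -
  let ?A = "Track k j ` {u. u < 2 * g k \<and> (u = t + 1 \<or> t = u + 1)}"
  let ?B = "(\<lambda>(i, u). Drive k i j u) ` ({..<rounds k} \<times> parity_class (s k) t)"
  let ?C = "if t = 2 * g k - 1 then {Gate k j} else {}"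
  let ?D = "(\<lambda>(i, u). Drive (Suc k) j i u) ` (SIGMA i:{..<3}. parity_class (s (Suc k)) (t + i))"
  have "nb (Track k j t) = ((?A \<union> ?B) \<union> ?C) \<union> ?D"
    using assms by simp
  then have "sum f (nb (Track k j t)) = sum f ?A + sum f ?B + sum f ?C + sum f ?D"
    using assms
    by (simp only:, subst sum.union_disjoint; (subst sum.union_disjoint)?; (subst sum.union_disjoint)?) auto
  moreover have "sum f ?A = (if 0 < t then f (Track k j (t - 1)) else 0)
      + (if t + 1 < 2 * g k then f (Track k j (t + 1)) else 0)"
    using path_sum[OF assms(2), of "\<lambda>u. f (Track k j u)"]
    by (subst sum.reindex) (simp_all add: inj_on_def comp_def)
  moreover have "sum f ?B = (\<Sum>i<rounds k. \<Sum>u\<in>parity_class (s k) t. f (Drive k i j u))"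
    by (subst sum.reindex) (auto simp: inj_on_def sum.cartesian_product split_def)
  moreover have "sum f ?C = (if t + 1 < 2 * g k then 0 else f (Gate k j))"
    using assms by auto
  moreover have "sum f ?D = (\<Sum>i<3. \<Sum>u\<in>parity_class (s (Suc k)) (t + i). f (Drive (Suc k) j i u))"
    by (subst sum.reindex) (auto simp: inj_on_def sum.Sigma split_def)
  ultimately show ?thesis
    by simp
qed

lemma sum_nb_Track_0:
  fixes f :: "vertex \<Rightarrow> int"
  shows "sum f (nb (Track 0 0 t)) = (\<Sum>u\<in>parity_class (g 0) t. f (Track 0 0 u))
    + (\<Sum>i<3. \<Sum>u\<in>parity_class (s 1) (t + i). f (Drive 1 0 i u))"
proof -
  let ?D = "(\<lambda>(i, u). Drive (Suc 0) 0 i u) ` (SIGMA i:{..<3}. parity_class (s (Suc 0)) (t + i))"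
  have "sum f (nb (Track 0 0 t)) = sum f (Track 0 0 ` parity_class (g 0) t) + sum f ?D"
    by (simp, subst sum.union_disjoint) auto
  moreover have "sum f (Track 0 0 ` parity_class (g 0) t) = (\<Sum>u\<in>parity_class (g 0) t. f (Track 0 0 u))"
    by (subst sum.reindex) (auto simp: inj_on_def)
  moreover have "sum f ?D = (\<Sum>i<3. \<Sum>u\<in>parity_class (s 1) (t + i). f (Drive 1 0 i u))"
    by (subst sum.reindex) (auto simp: inj_on_def sum.Sigma split_def)
  ultimately show ?thesis
    by simp
qed

lemma sum_nb_Drive:
  fixes f :: "vertex \<Rightarrow> int"
  assumes "0 < k" "t < 2 * s k"
  shows "sum f (nb (Drive k i j t)) =
    (\<Sum>u\<in>parity_class (g (k - 1)) (t + j). f (Track (k - 1) i u))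
    + (\<Sum>u\<in>parity_class (g k) t. f (Track k j u))
    + (if 0 < t then f (Drive k i j (t - 1)) else 0)
    + (if t + 1 < 2 * s k then f (Drive k i j (t + 1)) else f (Gate k j))
    + (if t = 0 \<and> 0 < j then f (Gate k (j - 1)) else 0)
    + (if t = 0 \<and> j = 2 then f (Relay k) else 0)"
proof -
  let ?A = "Track (k - 1) i ` parity_class (g (k - 1)) (t + j)"
  let ?B = "Track k j ` parity_class (g k) t"
  let ?C = "Drive k i j ` {u. u < 2 * s k \<and> (u = t + 1 \<or> t = u + 1)}"
  let ?D = "if t = 0 \<and> j > 0 then {Gate k (j - 1)} else {}"
  let ?E = "if t = 0 \<and> j = 2 then {Relay k} else {}"
  let ?F = "if t = 2 * s k - 1 then {Gate k j} else {}"
  have "nb (Drive k i j t) = ((((?A \<union> ?B) \<union> ?C) \<union> ?D) \<union> ?E) \<union> ?F"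
    by simp
  then have "sum f (nb (Drive k i j t)) = sum f ?A + sum f ?B + sum f ?C + sum f ?D + sum f ?E + sum f ?F"
    using assms
    by (simp only:, subst sum.union_disjoint; (subst sum.union_disjoint)?; (subst sum.union_disjoint)?;
        (subst sum.union_disjoint)?; (subst sum.union_disjoint)?) auto
  moreover have "sum f ?A = (\<Sum>u\<in>parity_class (g (k - 1)) (t + j). f (Track (k - 1) i u))"
    by (subst sum.reindex) (auto simp: inj_on_def)
  moreover have "sum f ?B = (\<Sum>u\<in>parity_class (g k) t. f (Track k j u))"
    by (subst sum.reindex) (auto simp: inj_on_def)
  moreover have "sum f ?C = (if 0 < t then f (Drive k i j (t - 1)) else 0)
      + (if t + 1 < 2 * s k then f (Drive k i j (t + 1)) else 0)"
    using path_sum[OF assms(2), of "\<lambda>u. f (Drive k i j u)"]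
    by (subst sum.reindex) (simp_all add: inj_on_def comp_def)
  ultimately show ?thesis
    using assms by auto
qed

lemma sum_nb_Gate:
  fixes f :: "vertex \<Rightarrow> int"
  assumes "1 \<le> k" "k \<le> K"
  shows "sum f (nb (Gate k j)) = f (Track k j (2 * g k - 1))
    + (\<Sum>i<rounds k. f (Drive k i j (2 * s k - 1)))
    + (if j < 2 then \<Sum>i<rounds k. f (Drive k i (j + 1) 0) else f (Relay k))
    + (if k < K then f (Relay (Suc k)) else 0)"
proof -
  let ?A = "{Track k j (2 * g k - 1)}"
  let ?B = "(\<lambda>i. Drive k i j (2 * s k - 1)) ` {..<rounds k}"
  let ?C = "if j < 2 then (\<lambda>i. Drive k i (j + 1) 0) ` {..<rounds k} else {Relay k}"
  let ?D = "if k < K then {Relay (Suc k)} else {}"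
  have "nb (Gate k j) = ((?A \<union> ?B) \<union> ?C) \<union> ?D"
    by simp
  then have "sum f (nb (Gate k j)) = sum f ?A + sum f ?B + sum f ?C + sum f ?D"
    using assms
    by (simp only:, subst sum.union_disjoint; (subst sum.union_disjoint)?; (subst sum.union_disjoint)?) auto
  moreover have "sum f ?B = (\<Sum>i<rounds k. f (Drive k i j (2 * s k - 1)))"
    by (subst sum.reindex) (auto simp: inj_on_def)
  moreover have "sum f ?C = (if j < 2 then \<Sum>i<rounds k. f (Drive k i (j + 1) 0) else f (Relay k))"
    by (auto simp: sum.reindex inj_on_def)
  ultimately show ?thesis
    by auto
qed

lemma sum_nb_Relay:
  fixes f :: "vertex \<Rightarrow> int"
  shows "sum f (nb (Relay k)) = f (Gate k 2) + (\<Sum>i<rounds k. f (Drive k i 2 0))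
    + (if 1 < k then \<Sum>j<3. f (Gate (k - 1) j) else 0)"
proof -
  let ?B = "(\<lambda>i. Drive k i 2 0) ` {..<rounds k}"
  let ?D = "if 1 < k then Gate (k - 1) ` {..<3} else {}"
  have "nb (Relay k) = ({Gate k 2} \<union> ?B) \<union> ?D"
    by simp
  then have "sum f (nb (Relay k)) = sum f {Gate k 2} + sum f ?B + sum f ?D"
    by (simp only:, subst sum.union_disjoint; (subst sum.union_disjoint)?) auto
  moreover have "sum f ?B = (\<Sum>i<rounds k. f (Drive k i 2 0))"
    by (subst sum.reindex) (auto simp: inj_on_def)
  moreover have "sum f ?D = (if 1 < k then \<Sum>j<3. f (Gate (k - 1) j) else 0)"
    by (auto simp: sum.reindex inj_on_def)
  ultimately show ?thesis
    by simp
qed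

end

lemma flip_sign_mult_self [simp]: "flip_sign b * flip_sign b = 1" "flip_sign b * (flip_sign b * a) = a"
  by (simp_all add: flip_sign_def)

section \<open>States and spins\<close>

context relay_graph
begin

text \<open>The color before any flip, as a parity. It alternates along each path, so a flipped
  initial segment meets the rest in a single edge with equal colors, the domain wall.\<close>

fun base :: "vertex \<Rightarrow> nat" where
  "base (Track k j t) = j + t"
| "base (Drive k i j t) = i + j + t"
| "base (Gate k j) = j"
| "base (Relay k) = 1"

text \<open>
  A state is described by three functions of the level: \<open>w k\<close> counts the completed rounds of level
  \<open>k\<close>, \<open>c k\<close> the tracks completed in its current round, and \<open>x k\<close> the nodes switched so far on
  drive and track number \<open>c k\<close>.  A front is the position of the domain wall on a path, possibly
  beyond its end.  At level \<open>0\<close> the value \<open>x 0 = M 0\<close> makes the static track count as flipped.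
\<close>

definition track_front :: "(nat \<Rightarrow> nat) \<Rightarrow> (nat \<Rightarrow> nat) \<Rightarrow> nat \<Rightarrow> nat \<Rightarrow> nat" where
  "track_front c x k j = (if j < c k then 2 * g k else if j = c k then x k - 2 * s k else 0)"

definition cycle_front :: "(nat \<Rightarrow> nat) \<Rightarrow> (nat \<Rightarrow> nat) \<Rightarrow> nat \<Rightarrow> nat \<Rightarrow> nat" where
  "cycle_front c x k j = (if j < c k then 2 * s k else if j = c k then x k else 0)"

text \<open>\<open>w k - 3 * w (k - 1)\<close> is the number of rounds that level \<open>k\<close>
  has completed within the current round of level \<open>k - 1\<close>, hence the index of the
  drives in use.\<close>

definition drive_front :: "(nat \<Rightarrow> nat) \<Rightarrow> (nat \<Rightarrow> nat) \<Rightarrow> (nat \<Rightarrow> nat) \<Rightarrow> nat \<Rightarrow> nat \<Rightarrow> nat \<Rightarrow> nat" where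
  "drive_front w c x k i j = (if i < w k - 3 * w (k - 1) then 2 * s k
     else if i = w k - 3 * w (k - 1) then cycle_front c x k j else 0)"

text \<open>A drive switches once per round of the level above, the other nodes once per round of
  their own level.\<close>

fun flips :: "(nat \<Rightarrow> nat) \<Rightarrow> (nat \<Rightarrow> nat) \<Rightarrow> (nat \<Rightarrow> nat) \<Rightarrow> vertex \<Rightarrow> nat" where
  "flips w c x (Track k j t) = w k + of_bool (t < track_front c x k j)"
| "flips w c x (Drive k i j t) = w (k - 1) + of_bool (t < drive_front w c x k i j)"
| "flips w c x (Gate k j) = w k + of_bool (j < c k)"
| "flips w c x (Relay k) = w k"

definition spin :: "(nat \<Rightarrow> nat) \<Rightarrow> (nat \<Rightarrow> nat) \<Rightarrow> (nat \<Rightarrow> nat) \<Rightarrow> vertex \<Rightarrow> int" where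
  "spin w c x v = alt (base v + flips w c x v)"

lemma spin_simps:
  "spin w c x (Track k j t) = alt (j + t + w k) * flip_sign (t < track_front c x k j)"
  "spin w c x (Drive k i j t) = alt (i + j + t + w (k - 1)) * flip_sign (t < drive_front w c x k i j)"
  "spin w c x (Gate k j) = alt (j + w k) * flip_sign (j < c k)"
  "spin w c x (Relay k) = - alt (w k)"
  by (simp_all add: spin_def alt_add alt_of_bool) (simp_all add: alt_def)

text \<open>A node is switchable if and only if its tension is positive.\<close>

definition tension :: "(nat \<Rightarrow> nat) \<Rightarrow> (nat \<Rightarrow> nat) \<Rightarrow> (nat \<Rightarrow> nat) \<Rightarrow> vertex \<Rightarrow> int" where
  "tension w c x v = spin w c x v * (\<Sum>u\<in>nb v. spin w c x u)"

section \<open>Tensions in terms of the fronts\<close>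

lemma sum_class_Track:
  "(\<Sum>u\<in>parity_class n a. spin w c x (Track k j u))
    = - alt (j + w k + a) * class_sum n a (track_front c x k j)"
proof -
  have "(\<Sum>u\<in>parity_class n a. spin w c x (Track k j u))
    = alt (j + w k) * (\<Sum>u\<in>parity_class n a. alt u * flip_sign (u < track_front c x k j))"
    by (simp add: spin_simps alt_add sum_distrib_left mult_ac)
  then show ?thesis
    by (simp add: alternating_class_sum alt_add)
qed

lemma sum_class_Drive:
  "(\<Sum>u\<in>parity_class n a. spin w c x (Drive k i j u))
    = - alt (i + j + w (k - 1) + a) * class_sum n a (drive_front w c x k i j)"
proof -
  have "(\<Sum>u\<in>parity_class n a. spin w c x (Drive k i j u))
    = alt (i + j + w (k - 1)) * (\<Sum>u\<in>parity_class n a. alt u * flip_sign (u < drive_front w c x k i j))"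
    by (simp add: spin_simps alt_add sum_distrib_left mult_ac)
  then show ?thesis
    by (simp add: alternating_class_sum alt_add)
qed

lemma alt_numerals [simp]: "alt (Suc 0) = -1" "alt 0 = 1" "alt (Suc n) = - alt n" "alt 2 = 1" "alt 3 = -1"
  by (simp_all add: alt_def)

lemma alt_pred: "0 < n \<Longrightarrow> alt (n - Suc 0) = - alt n"
  by (cases n) auto

lemma alt_triple: "alt (3 * n) = alt n" by (simp add: alt_def)

context
  fixes w c x :: "nat \<Rightarrow> nat" and k e :: nat
  assumes we: "w k = 3 * w (k - 1) + e"
begin

lemma alt_we: "alt (w k) = alt (w (k - Suc 0)) * alt e"
  by (simp add: we alt_add alt_triple)

text \<open>Here \<open>e\<close> counts the rounds of level \<open>k\<close> completed in the
  current round of level \<open>k - 1\<close>. The sign \<open>alt (i + e)\<close> of the lower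
  track, the gates and the relay is 1 for the drive in use, \<open>i = e\<close>.\<close>

lemma tension_Drive:
  assumes k: "0 < k" and t: "t < 2 * s k"
  shows "tension w c x (Drive k i j t) = - flip_sign (t < drive_front w c x k i j) *
    (class_sum (g (k - 1)) (t + j) (track_front c x (k - 1) i)
     + alt (i + e) * class_sum (g k) t (track_front c x k j)
     + (if 0 < t then flip_sign (t - 1 < drive_front w c x k i j) else 0)
     + (if t + 1 < 2 * s k then flip_sign (t + 1 < drive_front w c x k i j)
        else alt (i + e) * flip_sign (j < c k))
     + (if t = 0 \<and> 0 < j then alt (i + e) * flip_sign (j - 1 < c k) else 0)
     + (if t = 0 \<and> j = 2 then alt (i + e) else 0))"
proof -
  \<comment> \<open>The last position is odd. As the base color of a gate has no summand
    \<open>t\<close>, this sign makes the gate act like a successor on the path.\<close>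
  have "alt t = -1" if "\<not> t + 1 < 2 * s k"
    using that t by (auto simp: alt_def)
  moreover have "Suc t < 2 * s k" if "t = 0"
    using that t by auto
  ultimately show ?thesis
    unfolding tension_def sum_nb_Drive[OF k t] sum_class_Track
    by (auto simp: spin_simps alt_add alt_pred alt_we algebra_simps)
qed

context
  assumes e_le: "e \<le> rounds k" and idle: "e = rounds k \<Longrightarrow> c k = 0 \<and> x k = 0"
begin

text \<open>
  The drives of one track switch in alternating directions, so all but the current one cancel.
\<close>

lemma sum_rounds:
  fixes F :: "nat \<Rightarrow> int"
  assumes "F (2 * s k) = - F 0"
  shows "(\<Sum>i<rounds k. alt (i + e) * F (drive_front w c x k i j)) = F (cycle_front c x k j)"
proof -
  have we': "w k - 3 * w (k - 1) = e"
    by (simp add: we)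
  \<comment> \<open>For \<open>e = rounds k\<close> no drive is in use; the sum over the finished
    ones is \<open>- F (2 * s k) = F 0\<close>, and \<open>cycle_front\<close> is 0 by
    \<open>idle\<close>.\<close>
  have e: "rounds k = 1 \<and> (e = 0 \<or> e = 1) \<or> rounds k = 3 \<and> (e = 0 \<or> e = 1 \<or> e = 2 \<or> e = 3)"
    using e_le by (auto simp: rounds_def split: if_splits)
  have sum_3: "(\<Sum>i<3. G i) = G 0 + G 1 + G 2" for G :: "nat \<Rightarrow> int"
    by (simp add: eval_nat_numeral)
  show ?thesis
    using e idle assms unfolding drive_front_def we'
    by (elim disjE conjE) (simp_all add: sum_3 cycle_front_def eval_nat_numeral)
qed

text \<open>By \<open>sum_rounds\<close> all upper drives together act on the track like a single
  drive with front \<open>cycle_front\<close>.\<close>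

lemma tension_Track:
  assumes k: "0 < k" "k \<le> K" and t: "t < 2 * g k"
  shows "tension w c x (Track k j t) = - flip_sign (t < track_front c x k j) *
    (class_sum (s k) t (cycle_front c x k j)
     + (\<Sum>i<3. class_sum (s (Suc k)) (t + i) (drive_front w c x (Suc k) j i))
     + (if 0 < t then flip_sign (t - 1 < track_front c x k j) else 0)
     + (if t + 1 < 2 * g k then flip_sign (t + 1 < track_front c x k j) else flip_sign (j < c k)))"
proof -
  have last: "alt t = -1" if "\<not> t + 1 < 2 * g k"
    using that t by (auto simp: alt_def)
  have parents: "(\<Sum>i<rounds k. \<Sum>u\<in>parity_class (s k) t. spin w c x (Drive k i j u))
    = - alt (j + t + w k) * class_sum (s k) t (cycle_front c x k j)"
  proof -
    have "(\<Sum>i<rounds k. \<Sum>u\<in>parity_class (s k) t. spin w c x (Drive k i j u))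
      = - alt (j + t + w k) *
        (\<Sum>i<rounds k. alt (i + e) * class_sum (s k) t (drive_front w c x k i j))"
      by (simp add: sum_class_Drive sum_distrib_left alt_add alt_we mult_ac sum_negf)
    then show ?thesis
      using sum_rounds[of "class_sum (s k) t" j] by (simp add: class_sum_0 class_sum_full)
  qed
  have children: "(\<Sum>i<3. \<Sum>u\<in>parity_class (s (Suc k)) (t + i). spin w c x (Drive (Suc k) j i u))
    = - alt (j + t + w k) * (\<Sum>i<3. class_sum (s (Suc k)) (t + i) (drive_front w c x (Suc k) j i))"
    by (simp add: sum_class_Drive sum_distrib_left alt_add mult_ac sum_negf)
  show ?thesis
    using last unfolding tension_def sum_nb_Track[OF k(1) t] parents children
    by (auto simp: spin_simps alt_add alt_pred algebra_simps)
qed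

text \<open>\<open>e'\<close> counts the rounds of level \<open>k + 1\<close> completed in the
  current round of level \<open>k\<close>; through its parity the relay of level
  \<open>k + 1\<close> blocks or releases the gate.\<close>

lemma tension_Gate:
  assumes k: "0 < k" "k \<le> K" and j: "j < 3" and we': "k < K \<Longrightarrow> w (Suc k) = 3 * w k + e'"
  shows "tension w c x (Gate k j) = - flip_sign (j < c k) *
    (flip_sign (2 * g k - 1 < track_front c x k j) + flip_sign (2 * s k - 1 < cycle_front c x k j)
     + (if j < 2 then flip_sign (0 < cycle_front c x k (j + 1)) else 1)
     + (if k < K then alt (j + e') else 0))"
proof -
  have odd: "alt (2 * g k - 1) = -1" "alt (2 * s k - 1) = -1"
    using g_pos[of k] s_pos[OF k(2)] by (auto simp: alt_def)
  have row: "(\<Sum>i<rounds k. spin w c x (Drive k i l u))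
      = alt (l + u + w k) * flip_sign (u < cycle_front c x k l)" if "u < 2 * s k" for l u
  proof -
    have "(\<Sum>i<rounds k. spin w c x (Drive k i l u))
      = alt (l + u + w k) * (\<Sum>i<rounds k. alt (i + e) * flip_sign (u < drive_front w c x k i l))"
      by (simp add: spin_simps sum_distrib_left alt_add alt_we mult_ac)
    then show ?thesis
      using sum_rounds[of "\<lambda>\<tau>. flip_sign (u < \<tau>)" l] that by (simp add: flip_sign_def)
  qed
  have s: "2 * s k - 1 < 2 * s k" "0 < 2 * s k"
    using s_pos[OF k(2)] by simp_all
  have k1: "1 \<le> k"
    using k by simp
  have "alt (w (Suc k)) = alt (w k) * alt e'" if "k < K"
    using we'[OF that] by (simp add: alt_add alt_triple)
  moreover have "j = 0 \<or> j = 1 \<or> j = 2"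
    using j by auto
  ultimately show ?thesis
    using k odd unfolding tension_def sum_nb_Gate[OF k1 k(2)] row[OF s(1)] row[OF s(2)]
    by (auto simp: spin_simps alt_add algebra_simps)
qed

lemma tension_Relay:
  assumes k: "0 < k" "k \<le> K"
  shows "tension w c x (Relay k) =
    - (flip_sign (2 < c k) + flip_sign (0 < cycle_front c x k 2)
       + (if 1 < k then \<Sum>j<3. alt (j + e) * flip_sign (j < c (k - 1)) else 0))"
proof -
  have "(\<Sum>i<rounds k. spin w c x (Drive k i 2 0))
      = alt (w k) * (\<Sum>i<rounds k. alt (i + e) * flip_sign (0 < drive_front w c x k i 2))"
    by (simp add: spin_simps sum_distrib_left alt_add alt_we mult_ac)
  also have "\<dots> = alt (w k) * flip_sign (0 < cycle_front c x k 2)"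
    using sum_rounds[of "\<lambda>\<tau>. flip_sign (0 < \<tau>)" 2] s_pos[OF k(2)] by (simp add: flip_sign_def)
  finally show ?thesis
    unfolding tension_def
    by (subst sum_nb_Relay)
      (auto simp: spin_simps alt_add alt_we algebra_simps sum_distrib_left)
qed

end
end

lemma tension_Track_0:
  assumes "w 0 = 0" "t < 2 * g 0" "c 0 = 0" "x 0 = M 0"
  shows "tension w c x (Track 0 0 t) \<le> 0"
proof -
  have y: "track_front c x 0 0 = 2 * g 0"
    using assms by (simp add: track_front_def M_def)
  have children: "(\<Sum>i<3. \<Sum>u\<in>parity_class (s 1) (t + i). spin w c x (Drive 1 0 i u))
    = - alt t * (\<Sum>i<3. class_sum (s 1) (t + i) (drive_front w c x 1 0 i))"
    using assms by (simp add: sum_class_Drive sum_distrib_left alt_add mult_ac sum_negf)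
  have "tension w c x (Track 0 0 t) = 
     - int (g 0) + (\<Sum>i<3. class_sum (s 1) (t + i) (drive_front w c x 1 0 i))"
    using assms unfolding tension_def sum_nb_Track_0 sum_class_Track children y
    by (simp add: class_sum_full spin_simps y flip_sign_def algebra_simps)
  moreover have "(\<Sum>i<3. class_sum (s 1) (t + i) (drive_front w c x 1 0 i)) \<le> of_nat (card {..<3::nat}) * int (s 1)"
    by (rule sum_bounded_above) (rule class_sum_le)
  ultimately show ?thesis
    using g_0_ge by simp
qed

section \<open>Criteria for a positive tension, level by level\<close>

text \<open>
  The two cases: round \<open>c (k - 1)\<close> of level \<open>k\<close> is pending or running (running only if
  \<open>x (k - 1) = M (k - 1)\<close>), or it is complete and level \<open>k - 1\<close> has yet to advance.
\<close>

definition linked :: "(nat \<Rightarrow> nat) \<Rightarrow> (nat \<Rightarrow> nat) \<Rightarrow> (nat \<Rightarrow> nat) \<Rightarrow> nat \<Rightarrow> bool" where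
  "linked w c x k \<longleftrightarrow>
     (w k = 3 * w (k - 1) + c (k - 1) \<and> (x (k - 1) \<noteq> M (k - 1) \<longrightarrow> c k = 0 \<and> x k = 0)
      \<or> w k = 3 * w (k - 1) + c (k - 1) + 1 \<and> x (k - 1) = M (k - 1) \<and> c k = 0 \<and> x k = 0)
     \<and> c (k - 1) \<le> 3 \<and> x (k - 1) \<le> M (k - 1) \<and> (c (k - 1) = 3 \<longrightarrow> x (k - 1) = 0)
     \<and> c k \<le> 3 \<and> x k \<le> M k \<and> (c k = 3 \<longrightarrow> x k = 0)
     \<and> (k = 1 \<longrightarrow> c 0 = 0 \<and> x 0 = M 0)"

lemma M_pos: "0 < M k"
  using g_pos by (simp add: M_def)

text \<open>\<open>e = c (k - 1) + 1\<close> comes with \<open>x (k - 1) = M (k - 1)\<close>, which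
  is positive and so excludes \<open>c (k - 1) = 3\<close>. For \<open>k = 1\<close> the fixed
  values at level \<open>0\<close> leave only \<open>e \<le> 1\<close>.\<close>

lemma linked_rounds:
  assumes "linked w c x k" "w k = 3 * w (k - 1) + e"
  shows "e \<le> rounds k" "e = rounds k \<Longrightarrow> c k = 0 \<and> x k = 0"
  using assms M_pos[of "k - 1"] by (auto simp: linked_def rounds_def split: if_splits)

text \<open>The upper track pulls with at most \<open>g (k - 1) = g k + 2\<close>, the lower one
  with at most \<open>g k\<close>. When both pull fully against each other, the path neighbors,
  gates and relay collected in \<open>R\<close> decide: only the node at the wall has
  \<open>R < 2\<close>.\<close>

lemma tension_Drive_pos_iff:
  assumes l: "linked w c x k" and k: "0 < k" "k \<le> K" and j: "j < 3" and t: "t < 2 * s k"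
  shows "0 < tension w c x (Drive k i j t) \<longleftrightarrow>
    x (k - 1) = M (k - 1) \<and> w k = 3 * w (k - 1) + c (k - 1) \<and> i = c (k - 1) \<and> j = c k \<and> t = x k"
proof -
  obtain e where e: "w k = 3 * w (k - 1) + e"
      "e = c (k - 1) \<and> (x (k - 1) \<noteq> M (k - 1) \<longrightarrow> c k = 0 \<and> x k = 0)
       \<or> e = c (k - 1) + 1 \<and> x (k - 1) = M (k - 1) \<and> c k = 0 \<and> x k = 0"
    using l unfolding linked_def by (metis add.assoc)
  have pf: "drive_front w c x k i j =
      (if i < e then 2 * s k else if i = e then cycle_front c x k j else 0)"
    by (simp add: drive_front_def e(1))
  define X where "X = class_sum (g (k - 1)) (t + j) (track_front c x (k - 1) i)"
  define Z where "Z = class_sum (g k) t (track_front c x k j)"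
  define a where "a = alt (i + e)"
  have a: "a = 1 \<or> a = -1"
    by (simp add: a_def alt_def)
  have g: "int (g (k - 1)) = int (g k) + 2"
    using g_rec[of k] k by simp
  have X: "- int (g (k - 1)) \<le> X" "X \<le> int (g (k - 1))"
    and Z: "- int (g k) \<le> Z" "Z \<le> int (g k)"
    by (simp_all add: X_def Z_def class_sum_le class_sum_ge)
  have t2: "t = 0 \<Longrightarrow> Suc t < 2 * s k"
    using t by auto
  define R where "R = (if 0 < t then flip_sign (t - 1 < drive_front w c x k i j) else 0)
     + (if t + 1 < 2 * s k then flip_sign (t + 1 < drive_front w c x k i j) else a * flip_sign (j < c k))
     + (if t = 0 \<and> 0 < j then a * flip_sign (j - 1 < c k) else 0)
     + (if t = 0 \<and> j = 2 then a else 0)"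
  have T: "tension w c x (Drive k i j t) = - flip_sign (t < drive_front w c x k i j) * (X + a * Z + R)"
    unfolding tension_Drive[where e = e, OF e(1) k(1) t] X_def Z_def a_def R_def by simp
  have aZ: "- int (g k) \<le> a * Z" "a * Z \<le> int (g k)"
    using a Z by auto
  have gp: "0 < g k" by (rule g_pos)
  consider (finished) "i < e" | (later) "i > e \<or> i = e \<and> e = c (k - 1) + 1"
    | (idle) "i = e" "e = c (k - 1)" "x (k - 1) \<noteq> M (k - 1)"
    | (active) "i = e" "e = c (k - 1)" "x (k - 1) = M (k - 1)"
    using e(2) by linarith
  then show ?thesis
  proof cases
    \<comment> \<open>The upper track has flipped for this round and pins the drive, whatever the
      lower track does.\<close>
    case finished
    then have "track_front c x (k - 1) i = 2 * g (k - 1)"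
      using e(2) by (auto simp: track_front_def M_def)
    then have "X = - int (g (k - 1))"
      by (simp add: X_def class_sum_full)
    moreover have "drive_front w c x k i j = 2 * s k"
      using finished unfolding pf by simp
    moreover from this have "R \<le> 2"
      using a t t2 unfolding R_def by (cases "t = 0"; cases "t + 1 < 2 * s k") (auto simp: flip_sign_def)
    ultimately have "tension w c x (Drive k i j t) \<le> 0"
      using t g aZ unfolding T by (simp add: flip_sign_def)
    then show ?thesis
      using finished e by auto
  next
    \<comment> \<open>The upper track has not started and pins the drive in its old
      position.\<close>
    case later
    then have "track_front c x (k - 1) i = 0"
      using e(2) by (auto simp: track_front_def)
    then have "X = int (g (k - 1))"
      by (simp add: X_def class_sum_0)
    moreover have "drive_front w c x k i j = 0"
      using later e(2) unfolding pf by (auto simp: cycle_front_def)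
    moreover from this have "-2 \<le> R"
      using a t t2 unfolding R_def by (cases "t = 0"; cases "t + 1 < 2 * s k") (auto simp: flip_sign_def)
    ultimately have "tension w c x (Drive k i j t) \<le> 0"
      using g aZ unfolding T by (simp add: flip_sign_def)
    then show ?thesis
      using later e by auto
  next
    \<comment> \<open>The upper track is unfinished. For \<open>j = 0\<close> its last position
      holds back the first node of the drive, for \<open>j > 0\<close> a gate does; every later node
      is held by its predecessor.\<close>
    case idle
    then have ck: "c k = 0" "x k = 0"
      using e(2) by auto
    then have p0: "drive_front w c x k i j = 0"
      using idle(1) unfolding pf by (auto simp: cycle_front_def)
    have "Z = int (g k)"
      using ck by (simp add: Z_def track_front_def class_sum_0)
    moreover have a1: "a = 1"
      using idle by (simp add: a_def alt_def)
    moreover have "- int (g (k - 1)) + 2 \<le> X" if "t = 0" "j = 0"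
    proof -
      have "track_front c x (k - 1) i < 2 * g (k - 1)"
      proof -
        have "x (k - 1) \<le> M (k - 1)"
          using l unfolding linked_def by blast
        then have "x (k - 1) < M (k - 1)"
          using idle(3) by simp
        then show ?thesis
          using g_pos[of "k - 1"] idle(1,2) unfolding track_front_def M_def by simp linarith
      qed
      then show ?thesis
        using that class_sum_ge_last[of _ "g (k - 1)" "t + j"] by (simp add: X_def)
    qed
    moreover have "(if t = 0 \<and> j = 0 then 1 else 2) \<le> R"
      using t t2 ck(1) unfolding R_def p0 a1 by (cases "t = 0"; cases "t + 1 < 2 * s k") (auto simp: flip_sign_def)
    ultimately have "tension w c x (Drive k i j t) \<le> 0"
      using g X unfolding T by (simp add: p0 flip_sign_def split: if_splits)
    then show ?thesis
      using idle by auto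
  next
    case active
    then have "track_front c x (k - 1) i = 2 * g (k - 1)"
      by (simp add: track_front_def M_def)
    then have Xv: "X = - int (g (k - 1))"
      by (simp add: X_def class_sum_full)
    have a1: "a = 1"
      using active by (simp add: a_def alt_def)
    have pf': "drive_front w c x k i j = cycle_front c x k j"
      using active(1) unfolding pf by simp
    consider "j < c k" | "j > c k" | "j = c k" "t < x k" | "j = c k" "x k \<le> t"
      by linarith
    then show ?thesis
    proof cases
      case 1
      then have "Z = - int (g k)"
        by (simp add: Z_def track_front_def class_sum_full)
      moreover have "R \<le> 2"
        using 1 a1 t t2 unfolding R_def pf'
        by (cases "t = 0"; cases "t + 1 < 2 * s k") (auto simp: cycle_front_def flip_sign_def)
      ultimately have "tension w c x (Drive k i j t) \<le> 0"
        using 1 g Xv a1 t unfolding T pf' by (simp add: cycle_front_def flip_sign_def)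
      then show ?thesis
        using 1 by auto
    next
      \<comment> \<open>The gate \<open>j - 1\<close> has not switched and holds the first
        node.\<close>
      case 2
      then have "Z = int (g k)"
        by (simp add: Z_def track_front_def class_sum_0)
      moreover have "2 \<le> R"
        using 2 a1 t t2 j unfolding R_def pf'
        by (cases "t = 0"; cases "t + 1 < 2 * s k") (auto simp: cycle_front_def flip_sign_def)
      ultimately have "tension w c x (Drive k i j t) \<le> 0"
        using 2 g Xv a1 unfolding T pf' by (simp add: cycle_front_def flip_sign_def)
      then show ?thesis
        using 2 by auto
    next
      case 3
      have "R \<le> 2"
        using 3 a1 t t2 j unfolding R_def pf'
        by (cases "t = 0"; cases "t + 1 < 2 * s k") (auto simp: cycle_front_def flip_sign_def)
      then have "tension w c x (Drive k i j t) \<le> 0"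
        using 3 g Xv a1 Z unfolding T pf' by (simp add: cycle_front_def flip_sign_def)
      then show ?thesis
        using 3 by auto
    next
      \<comment> \<open>Here \<open>x k < 2 * s k\<close>, so the lower track has not started and
        pulls fully against the upper one.\<close>
      case 4
      then have "Z = int (g k)"
        using t by (simp add: Z_def track_front_def class_sum_0)
      then have "0 < tension w c x (Drive k i j t) \<longleftrightarrow> R < 2"
        using 4 g Xv a1 unfolding T pf' by (auto simp: cycle_front_def flip_sign_def)
      also have "\<dots> \<longleftrightarrow> t = x k"
        using 4 a1 t t2 j unfolding R_def pf'
        by (cases "t = 0"; cases "t + 1 < 2 * s k") (auto simp: cycle_front_def flip_sign_def)
      finally have "0 < tension w c x (Drive k i j t) \<longleftrightarrow> t = x k" .
      then show ?thesis
        using 4 active e by auto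
    qed
  qed
qed

text \<open>The same balance as for drives: the upper drives pull with at most \<open>s k\<close>,
  the lower ones with at most \<open>3 * s (Suc k) = s k - 2\<close>.\<close>

lemma tension_Track_pos_iff:
  assumes l: "linked w c x k" "k < K \<Longrightarrow> linked w c x (Suc k)"
    and k: "0 < k" "k \<le> K" and t: "t < 2 * g k"
  shows "0 < tension w c x (Track k j t) \<longleftrightarrow> j = c k \<and> x k = 2 * s k + t"
proof -
  obtain e where e: "w k = 3 * w (k - 1) + e"
    using l(1) unfolding linked_def by (metis add.assoc)
  define A where "A = class_sum (s k) t (cycle_front c x k j)"
  define B where "B = (\<Sum>i<3. class_sum (s (Suc k)) (t + i) (drive_front w c x (Suc k) j i))"
  define R where "R = (if 0 < t then flip_sign (t - 1 < track_front c x k j) else 0)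
     + (if t + 1 < 2 * g k then flip_sign (t + 1 < track_front c x k j) else flip_sign (j < c k))"
  have T: "tension w c x (Track k j t) = - flip_sign (t < track_front c x k j) * (A + B + R)"
    unfolding A_def B_def R_def using tension_Track[where w = w and c = c and x = x and k = k and e = e, OF e linked_rounds[OF l(1) e] k t]
    by (simp add: algebra_simps)
  have A: "- int (s k) \<le> A" "A \<le> int (s k)"
    by (simp_all add: A_def class_sum_le class_sum_ge)
  have B: "B \<le> 3 * int (s (Suc k))" "- 3 * int (s (Suc k)) \<le> B"
    using sum_bounded_above[of "{..<3}" "\<lambda>i. class_sum (s (Suc k)) (t + i) (drive_front w c x (Suc k) j i)",
        OF class_sum_le]
      sum_bounded_below[of "{..<3}" _ "\<lambda>i. class_sum (s (Suc k)) (t + i) (drive_front w c x (Suc k) j i)",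
        OF class_sum_ge]
    by (simp_all add: B_def)
  have s: "int (s k) = 3 * int (s (Suc k)) + 2"
    using s_rec[OF k(2)] by simp
  consider "j < c k" | "j > c k" | "j = c k" "t < x k - 2 * s k" | "j = c k" "x k - 2 * s k \<le> t"
    by linarith
  then show ?thesis
  proof cases
    case 1
    then have "A = - int (s k)"
      by (simp add: A_def cycle_front_def class_sum_full)
    moreover have "R \<le> 2"
      by (auto simp: R_def flip_sign_def)
    ultimately show ?thesis
      using 1 s B t unfolding T by (simp add: flip_sign_def track_front_def)
  next
    case 2
    then have "A = int (s k)"
      by (simp add: A_def cycle_front_def class_sum_0)
    moreover have "0 \<le> R"
      using 2 by (simp add: R_def track_front_def flip_sign_def)
    ultimately show ?thesis
      using 2 s B unfolding T by (simp add: flip_sign_def track_front_def)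
  next
    case 3
    then have "A = - int (s k)"
      by (simp add: A_def cycle_front_def class_sum_full)
    moreover have "R \<le> 1"
      using 3 by (simp add: R_def flip_sign_def track_front_def)
    ultimately show ?thesis
      using 3 s B unfolding T by (simp add: flip_sign_def track_front_def)
  next
    case 4
    have xM: "x k \<noteq> M k"
      using 4 t by (auto simp: M_def)
    \<comment> \<open>Level \<open>k + 1\<close> is idle while track \<open>c k\<close> is
      unfinished, so its three drives on this track pull with full force; for \<open>k = K\<close>
      there are none.\<close>
    have B': "B = 3 * int (s (Suc k))"
    proof (cases "k < K")
      case True
      then have "w (Suc k) = 3 * w k + c k" "c (Suc k) = 0" "x (Suc k) = 0"
        using l(2) xM by (auto simp: linked_def)
      then have "drive_front w c x (Suc k) j i = 0" for i
        using 4 by (simp add: drive_front_def cycle_front_def)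
      then show ?thesis
        by (simp add: B_def class_sum_0)
    next
      case False
      then show ?thesis
        using k(2) B by simp
    qed
    have R: "R = (if 0 < t then flip_sign (t - 1 < x k - 2 * s k) else 0) + 1"
      using 4 by (simp add: R_def track_front_def flip_sign_def)
    have T': "tension w c x (Track k j t) = - (A + B + R)"
      using 4 unfolding T by (simp add: track_front_def flip_sign_def)
    show ?thesis
    proof (cases "x k < 2 * s k")
      case True
      \<comment> \<open>The first node of the track waits for the last node of the drive.\<close>
      have "- int (s k) + 2 \<le> A" if "t = 0"
        using 4 that True unfolding A_def
        by (intro class_sum_ge_last) (auto simp: cycle_front_def)
      then show ?thesis
        using True A B' s unfolding T' by (auto simp: R flip_sign_def)
    next
      case False
      then have "A = - int (s k)"
        using 4 by (simp add: A_def cycle_front_def class_sum_full)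
      then show ?thesis
        using False 4 B' s unfolding T' by (auto simp: R flip_sign_def)
    qed
  qed
qed

text \<open>Once track and drive are done, their ends outvote the next drives, or the own relay, by
  one. The vote \<open>E\<close> of the relay of level \<open>k + 1\<close> blocks the switch until
  that level has completed another round. At level \<open>K\<close> there is no such relay and
  \<open>E = 0\<close>.\<close>

lemma tension_Gate_pos_iff:
  assumes l: "linked w c x k" "k < K \<Longrightarrow> linked w c x (Suc k)"
    and k: "0 < k" "k \<le> K" and j: "j < 3"
  shows "0 < tension w c x (Gate k j) \<longleftrightarrow>
    j = c k \<and> x k = M k \<and> (k < K \<longrightarrow> w (Suc k) = 3 * w k + c k + 1)"
proof -
  obtain e where e: "w k = 3 * w (k - 1) + e"
    using l(1) unfolding linked_def by (metis add.assoc)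
  obtain e' where e': "k < K \<Longrightarrow> w (Suc k) = 3 * w k + e'"
      "k < K \<Longrightarrow> e' = c k \<or> e' = c k + 1 \<and> x k = M k"
    using l(2) unfolding linked_def by (metis add.assoc diff_Suc_1)
  have x: "x k \<le> M k" and c: "c k = 3 \<Longrightarrow> x k = 0" "c k \<le> 3"
    using l(1) by (auto simp: linked_def)
  note s = s_pos[OF k(2)] and g = g_pos[of k]
  define E where "E = (if k < K then alt (j + e') else 0)"
  have E: "E \<le> 1" "-1 \<le> E" "k < K \<Longrightarrow> E = alt (j + e')" "k = K \<Longrightarrow> E = 0"
    by (simp_all add: E_def alt_def)
  have T: "tension w c x (Gate k j) = - flip_sign (j < c k) *
    (flip_sign (2 * g k - 1 < track_front c x k j) + flip_sign (2 * s k - 1 < cycle_front c x k j)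
     + (if j < 2 then flip_sign (0 < cycle_front c x k (j + 1)) else 1) + E)"
    unfolding E_def using tension_Gate[where w = w and c = c and x = x and k = k and e = e, OF e linked_rounds[OF l(1) e] k j e'(1)] by simp
  consider "j < c k" | "j > c k" | "j = c k" "x k \<noteq> M k" | "j = c k" "x k = M k"
    by linarith
  then show ?thesis
  proof cases
    case 1
    then have "tension w c x (Gate k j) \<le> 0"
      using s g E(1) unfolding T by (simp add: track_front_def cycle_front_def flip_sign_def)
    then show ?thesis
      using 1 by simp
  next
    case 2
    then have "tension w c x (Gate k j) \<le> 0"
      using E(2) unfolding T by (simp add: track_front_def cycle_front_def flip_sign_def)
    then show ?thesis
      using 2 by simp
  next
    case 3
    then have "\<not> 2 * g k - 1 < x k - 2 * s k"
      using x g by (auto simp: M_def)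
    moreover have "0 \<le> E"
      using 3 e'(2) k(2) by (cases "k < K") (auto simp: E alt_def)
    ultimately have "tension w c x (Gate k j) \<le> 0"
      using 3 unfolding T by (simp add: track_front_def cycle_front_def flip_sign_def)
    then show ?thesis
      using 3 by simp
  next
    case 4
    then have "0 < tension w c x (Gate k j) \<longleftrightarrow> E < 1"
      using s g unfolding T by (auto simp: track_front_def cycle_front_def flip_sign_def M_def)
    also have "\<dots> \<longleftrightarrow> (k < K \<longrightarrow> e' = c k + 1)"
      using 4 e'(2) k(2) by (cases "k < K") (auto simp: E alt_def)
    finally show ?thesis
      using 4 e' by auto
  qed
qed

text \<open>The upper gates have a joint vote \<open>E\<close> of 1 or -1. The last gate and the
  drives of index \<open>2\<close> outvote it when they agree. They disagree only for
  \<open>c k = 2\<close>, when \<open>E = 1\<close> keeps the relay in place.\<close>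

lemma tension_Relay_pos_iff:
  assumes l: "linked w c x k" and k: "0 < k" "k \<le> K"
  shows "0 < tension w c x (Relay k) \<longleftrightarrow> c k = 3"
proof -
  obtain e where e: "w k = 3 * w (k - 1) + e"
      "e = c (k - 1) \<or> e = c (k - 1) + 1 \<and> c k = 0 \<and> x k = 0"
    using l unfolding linked_def by (metis add.assoc)
  have c: "c k \<le> 3" "c (k - 1) = 0 \<or> c (k - 1) = 1 \<or> c (k - 1) = 2 \<or> c (k - 1) = 3"
    using l by (auto simp: linked_def)
  define E where "E = (\<Sum>j<3. alt (j + e) * flip_sign (j < c (k - 1)))"
  have E: "if e = c (k - 1) then E = 1 else -1 \<le> E"
  proof -
    have "E = alt e * flip_sign (0 < c (k - 1)) - alt e * flip_sign (1 < c (k - 1)) + alt e * flip_sign (2 < c (k - 1))"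
      by (simp add: E_def eval_nat_numeral)
    then show ?thesis
      using c(2) e(2) by (elim disjE) (auto simp: flip_sign_def)
  qed
  have T: "tension w c x (Relay k) = - (flip_sign (2 < c k) + flip_sign (0 < cycle_front c x k 2)
      + (if 1 < k then E else 0))"
    unfolding E_def by (rule tension_Relay[where w = w and c = c and x = x and k = k and e = e, OF e(1) linked_rounds[OF l e(1)] k])
  show ?thesis
    using E e(2) c(1) s_pos[OF k(2)]
    unfolding T by (auto simp: flip_sign_def cycle_front_def split: if_splits)
qed

section \<open>Legal states and their unique switchable node\<close>

text \<open>
  Exactly the levels \<open>1, \<dots>, d\<close> are in the middle of a round, and \<open>d = 0\<close> is the final state.
\<close>

definition legal :: "nat \<Rightarrow> (nat \<Rightarrow> nat) \<Rightarrow> (nat \<Rightarrow> nat) \<Rightarrow> (nat \<Rightarrow> nat) \<Rightarrow> bool" where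
  "legal d w c x \<longleftrightarrow> d \<le> K \<and> w 0 = 0 \<and> c 0 = 0 \<and> x 0 = M 0
     \<and> (\<forall>k. 1 \<le> k \<and> k \<le> d \<longrightarrow> w k = 3 * w (k - 1) + c (k - 1))
     \<and> (\<forall>k<d. x k = M k \<and> c k < 3)
     \<and> c d \<le> 3 \<and> x d \<le> M d \<and> (c d = 3 \<longrightarrow> x d = 0)
     \<and> (d < K \<longrightarrow> w (Suc d) = 3 * w d + c d + of_bool (x d = M d))
     \<and> (\<forall>k. d < k \<and> k \<le> K \<longrightarrow> c k = 0 \<and> x k = 0 \<and> (Suc d < k \<longrightarrow> w k = 3 * w (k - 1)))"

lemma legalD:
  assumes "legal d w c x"
  shows "d \<le> K" "w 0 = 0" "c 0 = 0" "x 0 = M 0"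
    "\<And>k. 1 \<le> k \<Longrightarrow> k \<le> d \<Longrightarrow> w k = 3 * w (k - 1) + c (k - 1)"
    "\<And>k. k < d \<Longrightarrow> x k = M k" "\<And>k. k < d \<Longrightarrow> c k < 3"
    "c d \<le> 3" "x d \<le> M d" "c d = 3 \<Longrightarrow> x d = 0"
    "d < K \<Longrightarrow> w (Suc d) = 3 * w d + c d + of_bool (x d = M d)"
    "\<And>k. d < k \<Longrightarrow> k \<le> K \<Longrightarrow> c k = 0" "\<And>k. d < k \<Longrightarrow> k \<le> K \<Longrightarrow> x k = 0"
    "\<And>k. Suc d < k \<Longrightarrow> k \<le> K \<Longrightarrow> w k = 3 * w (k - 1)"
  using assms unfolding legal_def by auto

text \<open>For \<open>k \<le> d\<close> round \<open>c (k - 1)\<close> of level \<open>k\<close> is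
  running, for \<open>k = d + 1\<close> it is pending or just complete, and deeper levels are
  idle.\<close>

lemma legal_linked:
  assumes l: "legal d w c x" and k: "1 \<le> k" "k \<le> K"
  shows "linked w c x k"
proof -
  note L = legalD[OF l]
  consider "k \<le> d" | "k = Suc d" | "Suc d < k" by linarith
  then show ?thesis
  proof cases
    case 1
    then have "k - 1 < d"
      using k by simp
    moreover have "c k \<le> 3" "x k \<le> M k" "c k = 3 \<longrightarrow> x k = 0"
      using 1 L(6)[of k] L(7)[of k] L(8,9,10) by (cases "k = d"; simp)+
    ultimately show ?thesis
      unfolding linked_def using 1 k L(3-7) by force
  next
    case 2
    then show ?thesis
      unfolding linked_def using k L(3,4) L(8-13) by auto
  next
    case 3
    then have "c (k - 1) = 0" "x (k - 1) = 0" "c k = 0" "x k = 0" "w k = 3 * w (k - 1)"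
      using L(12)[of "k - 1"] L(13)[of "k - 1"] L(12)[of k] L(13)[of k] L(14)[of k] k by auto
    then show ?thesis
      unfolding linked_def using k 3 by auto
  qed
qed

text \<open>A round passes through drive, track and gate for each of the three tracks and ends with
  the relay.\<close>

definition token :: "nat \<Rightarrow> (nat \<Rightarrow> nat) \<Rightarrow> (nat \<Rightarrow> nat) \<Rightarrow> vertex" where
  "token d c x = (if c d = 3 then Relay d
     else if x d < 2 * s d then Drive d (c (d - 1)) (c d) (x d)
     else if x d < M d then Track d (c d) (x d - 2 * s d)
     else Gate d (c d))"

lemma token_in_vertices:
  assumes l: "legal d w c x" and d: "1 \<le> d"
  shows "token d c x \<in> vertices"
proof -
  note L = legalD[OF l]
  have "c (d - 1) < rounds d"
    using L(3) L(7)[of "d - 1"] d by (cases "d = 1") (auto simp: rounds_def)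
  then show ?thesis
    using L(1,8) d by (auto simp: token_def vertices_iff M_def)
qed

text \<open>Each criterion forces its level to be \<open>d\<close>: levels above wait for a round of
  the next level to be completed, and levels below are idle.\<close>

lemma tension_pos_iff:
  assumes l: "legal d w c x" and d: "1 \<le> d" and v: "v \<in> vertices"
  shows "0 < tension w c x v \<longleftrightarrow> v = token d c x"
proof (cases v)
  case (Track k j t)
  note L = legalD[OF l]
  show ?thesis
  proof (cases "k = 0")
    case True
    then show ?thesis
      using v tension_Track_0[of w t c x] L(2-4) d unfolding Track
      by (auto simp: vertices_iff token_def not_less)
  next
    case False
    then have k: "1 \<le> k" "k \<le> K" "t < 2 * g k" "j < 3"
      using v by (auto simp: Track vertices_iff)
    have "0 < tension w c x v \<longleftrightarrow> j = c k \<and> x k = 2 * s k + t"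
      unfolding Track using k legal_linked[OF l] by (intro tension_Track_pos_iff) auto
    moreover have "k = d" if "x k = 2 * s k + t"
      using that L(6)[of k] L(13)[of k] s_pos[of k] k by (fastforce simp: M_def)
    ultimately show ?thesis
      using L(8,10) s_pos[of d] k by (auto simp: Track token_def M_def split: if_splits)
  qed
next
  case (Drive k i j t)
  note L = legalD[OF l]
  have k: "1 \<le> k" "k \<le> K" "t < 2 * s k" "j < 3"
    using v by (auto simp: Drive vertices_iff)
  have iff: "0 < tension w c x v \<longleftrightarrow> x (k - 1) = M (k - 1) \<and> w k = 3 * w (k - 1) + c (k - 1)
      \<and> i = c (k - 1) \<and> j = c k \<and> t = x k"
    unfolding Drive using k legal_linked[OF l] by (intro tension_Drive_pos_iff) auto
  have "k = d" if "x (k - 1) = M (k - 1)" "w k = 3 * w (k - 1) + c (k - 1)" "t = x k"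
  proof (rule ccontr)
    assume "k \<noteq> d"
    then consider "k < d" | "k = Suc d" | "Suc d < k" by linarith
    then show False
      using that k L(6)[of k] L(11) L(13)[of "k - 1"] M_pos[of "k - 1"]
      by cases (auto simp: M_def)
  qed
  moreover have "x (d - 1) = M (d - 1)" "w d = 3 * w (d - 1) + c (d - 1)"
    using L(5,6) d by auto
  ultimately show ?thesis
    using iff k by (auto simp: Drive token_def split: if_splits)
next
  case (Gate k j)
  note L = legalD[OF l]
  have k: "1 \<le> k" "k \<le> K" "j < 3"
    using v by (auto simp: Gate vertices_iff)
  have iff: "0 < tension w c x v \<longleftrightarrow> j = c k \<and> x k = M k \<and> (k < K \<longrightarrow> w (Suc k) = 3 * w k + c k + 1)"
    unfolding Gate using k legal_linked[OF l] by (intro tension_Gate_pos_iff) auto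
  have "k = d" if "x k = M k" "k < K \<longrightarrow> w (Suc k) = 3 * w k + c k + 1"
  proof (rule ccontr)
    assume "k \<noteq> d"
    then consider "k < d" | "d < k" by linarith
    then show False
      using that k L(1) L(5)[of "Suc k"] L(13)[of k] M_pos[of k] by cases auto
  qed
  then show ?thesis
    using iff k L(8-11) M_pos[of d] by (auto simp: Gate token_def M_def split: if_splits)
next
  case (Relay k)
  note L = legalD[OF l]
  have k: "1 \<le> k" "k \<le> K"
    using v by (auto simp: Relay vertices_iff)
  have "0 < tension w c x v \<longleftrightarrow> c k = 3"
    unfolding Relay using k legal_linked[OF l] by (intro tension_Relay_pos_iff) auto
  moreover have "k = d" if "c k = 3"
    using that L(7)[of k] L(12)[of k] k by (cases k d rule: linorder_cases) auto
  ultimately show ?thesis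
    by (auto simp: Relay token_def split: if_splits)
qed

section \<open>The passage from one legal state to the next\<close>

text \<open>The number of switches made at level \<open>K\<close>.\<close>

definition progress :: "(nat \<Rightarrow> nat) \<Rightarrow> (nat \<Rightarrow> nat) \<Rightarrow> (nat \<Rightarrow> nat) \<Rightarrow> nat" where
  "progress w c x = w K * (3 * (M K + 1) + 1) + c K * (M K + 1) + x K"

text \<open>The switch advances the wall, or closes a track at its gate, or closes the round at the
  relay and returns control to level \<open>d - 1\<close>. It contributes to \<open>progress\<close>
  only if \<open>d = K\<close>.\<close>

lemma legal_step:
  assumes l: "legal d w c x" and d: "1 \<le> d"
  obtains d' w' c' x' where "legal d' w' c' x'" "progress w' c' x' \<le> progress w c x + 1"
    "\<And>v. v \<in> vertices \<Longrightarrow> flips w' c' x' v = flips w c x v + of_bool (v = token d c x)"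
proof -
  note L = legalD[OF l]
  have d1: "d - 1 < d" and e: "w d - 3 * w (d - 1) = c (d - 1)"
    using d L(5)[of d] by auto
  consider "c d < 3" "x d < M d" | "c d < 3" "x d = M d" | "c d = 3"
    using L(8,9) by linarith
  then show ?thesis
  proof cases
    case 1
    define x' where "x' = x(d := x d + 1)"
    \<comment> \<open>A finished track starts a round of the next level; at level \<open>K\<close>
      its gate follows directly.\<close>
    define d' where "d' = (if x d + 1 = M d \<and> d < K then d + 1 else d)"
    have "legal d' w c x'"
      using L 1 d M_pos unfolding legal_def d'_def x'_def by (auto simp: less_Suc_eq le_Suc_eq)
    moreover have "progress w c x' \<le> progress w c x + 1"
      by (simp add: progress_def x'_def)
    moreover have "flips w c x' v = flips w c x v + of_bool (v = token d c x)" if "v \<in> vertices" for v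
      using 1 e that
      by (cases v)
        (auto simp: token_def x'_def M_def vertices_iff drive_front_def track_front_def cycle_front_def)
    ultimately show ?thesis
      by (rule that)
  next
    case 2
    define x' where "x' = x(d := 0)"
    define c' where "c' = c(d := c d + 1)"
    have "legal d w c' x'"
      unfolding legal_def
    proof (intro conjI allI impI)
      show "w k = 3 * w (k - 1) + c' (k - 1)" if "1 \<le> k \<and> k \<le> d" for k
        using L(5)[of k] that by (auto simp: c'_def)
      show "w (Suc d) = 3 * w d + c' d + of_bool (x' d = M d)" if "d < K"
        using L(11)[OF that] 2 M_pos[of d] by (simp add: c'_def x'_def)
    qed (use L(1-4,6-10,12-14) 2 d in \<open>auto simp: c'_def x'_def\<close>)
    moreover have "progress w c' x' \<le> progress w c x + 1"
      using 2 by (simp add: progress_def c'_def x'_def)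
    moreover have "flips w c' x' v = flips w c x v + of_bool (v = token d c x)" if "v \<in> vertices" for v
      using 2 e that
      by (cases v)
        (auto simp: token_def x'_def c'_def M_def vertices_iff drive_front_def track_front_def cycle_front_def)
    ultimately show ?thesis
      by (rule that)
  next
    case 3
    \<comment> \<open>Tracks and gates of level \<open>d\<close> and drives of level
      \<open>d + 1\<close> exchange a flip within the round for one more completed round, so only
      the relay changes color.\<close>
    define w' where "w' = w(d := w d + 1)"
    define c' where "c' = c(d := 0)"
    have x: "x d = 0"
      using L(10) 3 .
    have "legal (d - 1) w' c' x"
      unfolding legal_def
    proof (intro conjI allI impI)
      show "w' k = 3 * w' (k - 1) + c' (k - 1)" if "1 \<le> k \<and> k \<le> d - 1" for k
        using L(5)[of k] that by (auto simp: c'_def w'_def)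
      show "w' (Suc (d - 1)) = 3 * w' (d - 1) + c' (d - 1) + of_bool (x (d - 1) = M (d - 1))"
      proof -
        have "Suc (d - 1) = d" "d - 1 \<noteq> d" "w d = 3 * w (d - 1) + c (d - 1)" "x (d - 1) = M (d - 1)"
          using L(5)[of d] L(6)[of "d - 1"] d by auto
        then show ?thesis
          by (simp only: c'_def w'_def fun_upd_apply if_True if_False simp_thms of_bool_eq)
      qed
      show "w' k = 3 * w' (k - 1)" if "d - 1 < k \<and> k \<le> K" "Suc (d - 1) < k" for k
      proof (cases "k = Suc d")
        case True
        then show ?thesis
          using L(11) that x 3 M_pos[of d] by (simp add: w'_def)
      next
        case False
        then show ?thesis
          using L(14)[of k] that d by (simp add: w'_def)
      qed
      show "c' k = 0" "x k = 0" if "d - 1 < k \<and> k \<le> K" for k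
        using L(12,13)[of k] that x d by (cases "k = d"; auto simp: c'_def)+
      show "x (d - 1) = 0" if "c' (d - 1) = 3"
        using that L(7)[OF d1] by (auto simp: c'_def split: if_splits)
    qed (use L(1-4,6,7) L(6)[OF d1] less_imp_le[OF L(7)[OF d1]] d in
        \<open>auto simp: c'_def w'_def\<close>)
    moreover have "progress w' c' x \<le> progress w c x + 1"
      using 3 x by (simp add: progress_def c'_def w'_def)
    moreover have "flips w' c' x v = flips w c x v + of_bool (v = token d c x)" if "v \<in> vertices" for v
    proof (cases v)
      case (Track k j t)
      then show ?thesis
      proof (cases "k = d")
        case True
        then have "j < 3" "t < 2 * g d"
          using Track that d by (auto simp: vertices_iff)
        then show ?thesis
          using True Track 3 x by (simp add: token_def w'_def c'_def track_front_def)
      next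
        case False
        then show ?thesis
          using Track 3 by (simp add: token_def w'_def c'_def track_front_def)
      qed
    next
      case (Gate k j)
      then show ?thesis
        using 3 that by (auto simp: token_def w'_def c'_def vertices_iff)
    next
      case (Relay k)
      then show ?thesis
        using 3 by (auto simp: token_def w'_def)
    next
      case (Drive k i j t)
      then have v: "1 \<le> k" "k \<le> K" "i < 3" "j < 3" "t < 2 * s k"
        using that by (auto simp: vertices_iff rounds_def split: if_splits)
      have nt: "v \<noteq> token d c x"
        using 3 Drive by (simp add: token_def)
      consider "k = d" | "k = Suc d" | "k \<noteq> d" "k \<noteq> Suc d"
        by blast
      then show ?thesis
      proof cases
        \<comment> \<open>The drives in use, with all three paths flipped, become finished ones
          without any switch.\<close>
        case 1
        have up: "w' d = w d + 1" "w' (d - 1) = w (d - 1)"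
          using d1 by (simp_all add: w'_def)
        moreover have "w d + 1 - 3 * w (d - 1) = c (d - 1) + 1"
          using L(5)[OF d order_refl] by linarith
        ultimately have "t < drive_front w' c' x d i j \<longleftrightarrow> i \<le> c (d - 1)"
          using v 1 x by (auto simp: drive_front_def cycle_front_def c'_def)
        moreover have "t < drive_front w c x d i j \<longleftrightarrow> i \<le> c (d - 1)"
          using v 1 3 e by (auto simp: drive_front_def cycle_front_def)
        ultimately show ?thesis
          using nt 1 Drive up by simp
      next
        case 2
        then have dK: "d < K"
          using v by simp
        have ch: "w (Suc d) = 3 * w d + 3" "c (Suc d) = 0" "x (Suc d) = 0"
          using L(11)[OF dK] L(12)[of "Suc d"] L(13)[of "Suc d"] dK 3 x M_pos[of d] by auto
        have "t < drive_front w c x (Suc d) i j"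
          using v 2 ch by (simp add: drive_front_def)
        moreover have "\<not> t < drive_front w' c' x (Suc d) i j"
          using ch by (simp add: drive_front_def cycle_front_def w'_def c'_def)
        ultimately show ?thesis
          using nt 2 Drive by (simp add: w'_def)
      next
        case 3
        then have "k - 1 \<noteq> d"
          using v by simp
        then show ?thesis
          using nt 3 Drive by (simp add: w'_def c'_def drive_front_def cycle_front_def)
      qed
    qed
    ultimately show ?thesis
      by (rule that)
  qed
qed

text \<open>Level \<open>K\<close> has made \<open>3 ^ (K - 1)\<close> rounds, each with three
  passes of more than \<open>2 * g K = 2 * 3 ^ (K + 1)\<close> switches.\<close>

lemma legal_final:
  assumes "legal 0 w c x"
  shows "6 * 9 ^ K \<le> progress w c x"
proof -
  note L = legalD[OF assms]
  have "w (Suc k) = 3 ^ k" if "k < K" for k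
    using that
  proof (induction k)
    case 0
    then show ?case using L(2-4,11) by simp
  next
    case (Suc k)
    then show ?case using L(14)[of "Suc (Suc k)"] by simp
  qed
  from this[of "K - 1"] have "w K = 3 ^ (K - 1)"
    using K_pos by simp
  then have "3 * w K = 3 ^ K"
    using K_pos by (cases K) auto
  moreover have "3 * w K * (2 * 3 ^ (K + 1)) \<le> progress w c x"
  proof -
    have "3 * w K * (2 * 3 ^ (K + 1)) \<le> 3 * w K * (M K + 1)"
      by (intro mult_left_mono) (auto simp: M_def g_def)
    also have "\<dots> \<le> progress w c x"
      by (simp add: progress_def algebra_simps)
    finally show ?thesis .
  qed
  moreover have "(3::nat) ^ K * 3 ^ K = 9 ^ K"
    by (simp flip: power_mult_distrib)
  ultimately show ?thesis
    by (simp add: algebra_simps)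
qed

lemma legal_initial: "legal 1 (\<lambda>_. 0) (\<lambda>_. 0) (\<lambda>k. if k = 0 then M 0 else 0)"
  using K_pos M_pos[of 1] by (auto simp: legal_def)

lemma progress_initial: "progress (\<lambda>_. 0) (\<lambda>_. 0) (\<lambda>k. if k = 0 then M 0 else 0) = 0"
  using K_pos by (simp add: progress_def)

end

section \<open>Reduction of the models to the free one\<close>

lemma execution_mono:
  assumes "\<And>col. \<not> stable_coloring G col \<Longrightarrow> R col \<subseteq> R' col" "execution G R col X"
  shows "execution G R' col X"
  using assms unfolding execution_def by (metis subsetD)

lemma benevolent_time_ge:
  assumes "\<And>X. execution G R col X \<Longrightarrow> e \<le> stabilization_time G X"
  shows "e \<le> benevolent_time G R col"
  unfolding benevolent_time_def using assms by (auto intro: INF_greatest)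

lemma synchronous_execution_free:
  "execution G (free_rule G) col (synchronous_execution G col)"
  by (auto simp: execution_def synchronous_execution_def free_rule_def stable_coloring_def switch_def)

lemma finite_switchable: "finite (pverts G) \<Longrightarrow> finite (switchable G col)"
  by (rule finite_subset[of _ "pverts G"]) (auto simp: switchable_def)

section \<open>The graph on natural numbers and its size\<close>

context relay_graph
begin

text \<open>Nodes are to be natural numbers; any injective renaming serves.\<close>

definition label :: "vertex \<Rightarrow> nat" where
  "label = (SOME f. inj_on f vertices)"

definition network :: "nat pair_pre_digraph" where
  "network = \<lparr>pverts = label ` vertices, parcs = {(label u, label v) | u v. u \<in> vertices \<and> v \<in> nb u}\<rparr>"

lemma vertices_subset:
  "vertices \<subseteq> (\<lambda>((k, j), t). Track k j t) ` (({..K} \<times> {..<3}) \<times> {..<2 * g 0})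
     \<union> (\<lambda>((k, i), (j, t)). Drive k i j t) ` (({1..K} \<times> {..<3}) \<times> ({..<3} \<times> {..<2 * s 1}))
     \<union> (\<lambda>(k, j). Gate k j) ` ({1..K} \<times> {..<3}) \<union> Relay ` {1..K}"
  (is "_ \<subseteq> ?A \<union> ?B \<union> ?C \<union> ?D")
proof
  have g: "g k \<le> g 0" for k
    by (simp add: g_def)
  have s: "s k \<le> s 1" if "1 \<le> k" for k
    using that by (auto simp: s_def intro!: diff_le_mono power_increasing)
  fix v assume v: "v \<in> vertices"
  show "v \<in> ?A \<union> ?B \<union> ?C \<union> ?D"
  proof (cases v)
    case (Track k j t)
    then have "t < 2 * g 0" "k \<le> K" "j < 3"
      using v g[of k] by (auto simp: vertices_iff split: if_splits)
    then have "v \<in> ?A"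
      using Track by force
    then show ?thesis by blast
  next
    case (Drive k i j t)
    then have "t < 2 * s 1" "1 \<le> k" "k \<le> K" "j < 3" "i < 3"
      using v s[of k] by (auto simp: vertices_iff rounds_def split: if_splits)
    then have "v \<in> ?B"
      using Drive by force
    then show ?thesis by blast
  next
    case (Gate k j)
    then have "v \<in> ?C"
      using v by (force simp: vertices_iff)
    then show ?thesis by blast
  next
    case (Relay k)
    then have "v \<in> ?D"
      using v by (force simp: vertices_iff)
    then show ?thesis by blast
  qed
qed

lemma finite_vertices: "finite vertices"
  by (rule finite_subset[OF vertices_subset]) simp

lemma card_vertices_le: "card vertices \<le> 82 * K * 3 ^ K"
proof -
  have "card vertices \<le> card ((\<lambda>((k, j), t). Track k j t) ` (({..K} \<times> {..<3}) \<times> {..<2 * g 0})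
     \<union> (\<lambda>((k, i), (j, t)). Drive k i j t) ` (({1..K} \<times> {..<3}) \<times> ({..<3} \<times> {..<2 * s 1}))
     \<union> (\<lambda>(k, j). Gate k j) ` ({1..K} \<times> {..<3}) \<union> Relay ` {1..K})" (is "_ \<le> card (?A \<union> ?B \<union> ?C \<union> ?D)")
    by (intro card_mono vertices_subset) simp
  also have "\<dots> \<le> card ?A + card ?B + card ?C + card ?D"
    using card_Un_le[of "?A \<union> ?B \<union> ?C" ?D] card_Un_le[of "?A \<union> ?B" ?C] card_Un_le[of ?A ?B]
    by linarith
  also have "\<dots> \<le> (K + 1) * 3 * (2 * g 0) + K * 3 * (3 * (2 * s 1)) + K * 3 + K"
    by (intro add_mono; rule order.trans[OF card_image_le]) auto
  \<comment> \<open>Uses \<open>K + 1 \<le> 2 * K\<close>,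
    \<open>g 0 = 3 * 3 ^ K + 2 * K \<le> 5 * 3 ^ K\<close> and \<open>s 1 \<le> 3 ^ K\<close>; the
    coefficients add up to 60 + 18 + 3 + 1 = 82.\<close>
  also have "\<dots> \<le> 2 * K * 3 * (2 * (5 * 3 ^ K)) + K * 3 * (3 * (2 * 3 ^ K)) + K * 3 * 3 ^ K + K * 3 ^ K"
  proof (intro add_mono mult_mono)
    have "K \<le> 3 ^ K"
      by (simp add: less_imp_le power_gt_expt)
    then show "g 0 \<le> 5 * 3 ^ K"
      by (simp add: g_def)
  qed (use K_pos power_increasing[of 1 K "3::nat"] in \<open>auto simp: s_def\<close>)
  also have "\<dots> = 82 * K * 3 ^ K"
    by (simp add: algebra_simps)
  finally show ?thesis .
qed

text \<open>Makes the sizes unbounded and later controls the negative power of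
  \<open>n\<close>.\<close>

lemma card_vertices_ge: "3 ^ K \<le> card vertices"
proof -
  have "3 ^ K \<le> card (Track 0 0 ` {..<2 * g 0})"
    by (subst card_image) (auto simp: inj_on_def g_def)
  also have "\<dots> \<le> card vertices"
    by (intro card_mono finite_vertices) (auto simp: vertices_iff)
  finally show ?thesis .
qed

lemma inj_label: "inj_on label vertices"
proof -
  obtain f :: "vertex \<Rightarrow> nat" where "inj_on f vertices"
    using finite_imp_inj_to_nat_seg[OF finite_vertices] by metis
  then have ex: "\<exists>f :: vertex \<Rightarrow> nat. inj_on f vertices"
    by (rule exI[of _ f])
  show ?thesis
    unfolding label_def by (rule someI_ex[OF ex])
qed

lemma card_network: "card (pverts network) = card vertices"
  by (simp add: network_def card_image inj_label)

lemma pair_graph_network: "pair_graph network"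
proof
  show "finite (pverts network)"
    by (simp add: network_def finite_vertices)
  show "finite (parcs network)"
    by (rule finite_subset[of _ "(label ` vertices) \<times> (label ` vertices)"])
      (use nb_sub finite_vertices in \<open>auto simp: network_def\<close>)
  show "fst e \<in> pverts network" "snd e \<in> pverts network" "fst e \<noteq> snd e"
    if arc: "e \<in> parcs network" for e
  proof -
    obtain u v where e: "e = (label u, label v)" "u \<in> vertices" "v \<in> nb u"
      using arc by (auto simp: network_def)
    moreover have "v \<in> vertices"
      using nb_sub e(2,3) by blast
    moreover have "v \<noteq> u"
      using nb_irrefl e(2,3) by blast
    ultimately show "fst e \<in> pverts network" "snd e \<in> pverts network" "fst e \<noteq> snd e"
      using inj_on_eq_iff[OF inj_label] by (simp_all add: network_def)
  qed
  show "symmetric (with_proj network)"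
    unfolding symmetric_def with_proj_simps
  proof (rule symI)
    fix a b assume "(a, b) \<in> parcs network"
    then obtain u v where "a = label u" "b = label v" "u \<in> vertices" "v \<in> nb u"
      by (auto simp: network_def)
    then show "(b, a) \<in> parcs network"
      using nb_sub[of u v] nb_sym[of u v] by (auto simp: network_def)
  qed
qed

lemma neighbors_network:
  assumes v: "v \<in> vertices"
  shows "neighbors network (label v) = label ` nb v"
proof (intro equalityI subsetI)
  fix n assume "n \<in> neighbors network (label v)"
  then obtain v' u where "label v = label v'" "n = label u" "v' \<in> vertices" "u \<in> nb v'"
    by (auto simp: neighbors_def network_def)
  then show "n \<in> label ` nb v"
    using v inj_on_eq_iff[OF inj_label] by auto
qed (use v in \<open>auto simp: neighbors_def network_def\<close>)

section \<open>Executions follow the legal states\<close>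

definition shows_state ::
    "(nat \<Rightarrow> nat) \<Rightarrow> (nat \<Rightarrow> nat) \<Rightarrow> (nat \<Rightarrow> nat) \<Rightarrow> nat coloring \<Rightarrow> bool" where
  "shows_state w c x col \<longleftrightarrow>
     (\<forall>v\<in>vertices. col (label v) = (if spin w c x v = 1 then Black else White))"

lemma spin_cases: "spin w c x v = 1 \<or> spin w c x v = -1"
  by (simp add: spin_def alt_def)

lemma opposite_eq_iff: "a = opposite b \<longleftrightarrow> a \<noteq> b"
  by (cases a; cases b) auto

text \<open>The product of two spins is 1 for equal colors and -1 otherwise, so the tension is the
  number of equally colored neighbors minus that of the others.\<close>

lemma label_in_switchable_iff:
  assumes "shows_state w c x col" "v \<in> vertices"
  shows "label v \<in> switchable network col \<longleftrightarrow> 0 < tension w c x v"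
proof -
  let ?N = "nb v" and ?\<sigma> = "spin w c x"
  have N: "?N \<subseteq> vertices" "finite ?N"
    using nb_sub[OF assms(2)] finite_subset[OF _ finite_vertices] by auto
  have inj: "inj_on label {u \<in> ?N. Q u}" for Q
    by (rule inj_on_subset[OF inj_label]) (use N(1) in blast)
  have eq: "col (label u) = col (label v) \<longleftrightarrow> ?\<sigma> u = ?\<sigma> v" if "u \<in> ?N" for u
    using assms N(1) that spin_cases[of w c x u] spin_cases[of w c x v]
    by (auto simp: shows_state_def)
  have "{n \<in> neighbors network (label v). col n = opposite (col (label v))}
      = label ` {u \<in> ?N. ?\<sigma> u \<noteq> ?\<sigma> v}"
    using eq by (auto simp: neighbors_network[OF assms(2)] opposite_eq_iff)
  then have opp: "card {n \<in> neighbors network (label v). col n = opposite (col (label v))}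
      = card {u \<in> ?N. ?\<sigma> u \<noteq> ?\<sigma> v}"
    by (simp add: card_image inj)
  have "{n \<in> neighbors network (label v). col n = col (label v)} = label ` {u \<in> ?N. ?\<sigma> u = ?\<sigma> v}"
    using eq by (auto simp: neighbors_network[OF assms(2)])
  then have same: "card {n \<in> neighbors network (label v). col n = col (label v)}
      = card {u \<in> ?N. ?\<sigma> u = ?\<sigma> v}"
    by (simp add: card_image inj)
  have "tension w c x v = (\<Sum>u\<in>?N. if ?\<sigma> u = ?\<sigma> v then 1 else -1)"
    unfolding tension_def sum_distrib_left
  proof (rule sum.cong)
    fix u
    show "?\<sigma> v * ?\<sigma> u = (if ?\<sigma> u = ?\<sigma> v then 1 else -1)"
      using spin_cases[of w c x u] spin_cases[of w c x v] by auto
  qed simp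
  also have "\<dots> = int (card {u \<in> ?N. ?\<sigma> u = ?\<sigma> v}) - int (card {u \<in> ?N. ?\<sigma> u \<noteq> ?\<sigma> v})"
  proof -
    have "?N \<inter> {u. ?\<sigma> u = ?\<sigma> v} = {u \<in> ?N. ?\<sigma> u = ?\<sigma> v}"
      "?N \<inter> - {u. ?\<sigma> u = ?\<sigma> v} = {u \<in> ?N. ?\<sigma> u \<noteq> ?\<sigma> v}"
      by auto
    then show ?thesis
      using N(2) by (simp only: sum.If_cases) simp
  qed
  finally show ?thesis
    using assms(2) by (simp add: switchable_def opp same) (auto simp: network_def)
qed

lemma switchable_network:
  assumes "legal d w c x" "1 \<le> d" "shows_state w c x col"
  shows "switchable network col = {label (token d c x)}"
proof -
  have "switchable network col = label ` {v \<in> vertices. label v \<in> switchable network col}"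
    by (auto simp: switchable_def network_def)
  also have "{v \<in> vertices. label v \<in> switchable network col} = {token d c x}"
    using label_in_switchable_iff[OF assms(3)] tension_pos_iff[OF assms(1,2)]
      token_in_vertices[OF assms(1,2)] by auto
  finally show ?thesis
    by simp
qed

lemma shows_state_step:
  assumes "shows_state w c x col" "v0 \<in> vertices"
    and flips: "\<And>v. v \<in> vertices \<Longrightarrow> flips w' c' x' v = flips w c x v + of_bool (v = v0)"
  shows "shows_state w' c' x' (switch {label v0} col)"
  unfolding shows_state_def
proof
  fix v assume v: "v \<in> vertices"
  have "spin w' c' x' v = (if v = v0 then - spin w c x v else spin w c x v)"
    using flips[OF v] by (simp add: spin_def)
  then show "switch {label v0} col (label v) = (if spin w' c' x' v = 1 then Black else White)"
    using assms(1,2) v spin_cases[of w c x v] inj_on_eq_iff[OF inj_label v assms(2)]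
    by (auto simp: shows_state_def switch_def)
qed

text \<open>Until the bound is passed, every coloring shows a legal state with
  \<open>d \<ge> 1\<close>, which is not stable. The free rule leaves only the choice between the
  token and the empty set, and idling costs time without progress.\<close>

lemma execution_slow:
  assumes X: "execution network (free_rule network) col X"
    and init: "shows_state (\<lambda>_. 0) (\<lambda>_. 0) (\<lambda>k. if k = 0 then M 0 else 0) col"
    and stable: "stable_coloring network (X t)"
  shows "6 * 9 ^ K \<le> t"
proof -
  define reached where "reached t \<longleftrightarrow> (\<exists>d w c x. legal d w c x \<and> 1 \<le> d \<and>
    shows_state w c x (X t) \<and> progress w c x \<le> t)" for t
  have "6 * 9 ^ K \<le> t \<or> reached t"
  proof (induction t)
    case 0
    have "X 0 = col"
      using X by (simp add: execution_def)
    then have "reached 0"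
      unfolding reached_def using legal_initial progress_initial init by fastforce
    then show ?case ..
  next
    case (Suc t)
    show ?case
    proof (cases "6 * 9 ^ K \<le> t")
      case False
      then obtain d w c x where st: "legal d w c x" "1 \<le> d" "shows_state w c x (X t)"
          "progress w c x \<le> t"
        using Suc by (auto simp: reached_def)
      note sw = switchable_network[OF st(1-3)]
      have "if stable_coloring network (X t) then X (Suc t) = X t
          else \<exists>S \<in> free_rule network (X t). X (Suc t) = switch S (X t)"
        using X unfolding execution_def by blast
      then obtain S where S: "S \<subseteq> {label (token d c x)}" "X (Suc t) = switch S (X t)"
        by (auto simp: stable_coloring_def free_rule_def sw)
      show ?thesis
      proof (cases "S = {}")
        case True
        then have "X (Suc t) = X t"
          using S by (simp add: switch_def)
        then have "reached (Suc t)"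
          unfolding reached_def using st le_SucI by metis
        then show ?thesis ..
      next
        case False
        then have S': "X (Suc t) = switch {label (token d c x)} (X t)"
          using S by (simp add: subset_singleton_iff)
        obtain d' w' c' x' where st': "legal d' w' c' x'" "progress w' c' x' \<le> progress w c x + 1"
            "\<And>v. v \<in> vertices \<Longrightarrow> flips w' c' x' v = flips w c x v + of_bool (v = token d c x)"
          by (rule legal_step[OF st(1,2)]) (rule that, assumption+)
        have shows': "shows_state w' c' x' (X (Suc t))"
          unfolding S' using st(3) token_in_vertices[OF st(1,2)] st'(3) by (rule shows_state_step)
        have p: "progress w' c' x' \<le> Suc t"
          using st'(2) st(4) by linarith
        show ?thesis
        proof (cases "d' = 0")
          case True
          then have "6 * 9 ^ K \<le> progress w' c' x'"
            using legal_final st'(1) by simp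
          then show ?thesis
            using p by linarith
        next
          case False
          then have "1 \<le> d'"
            by simp
          then have "reached (Suc t)"
            unfolding reached_def using st'(1) shows' p by blast
          then show ?thesis ..
        qed
      qed
    qed simp
  qed
  moreover have "\<not> reached t"
  proof
    assume "reached t"
    then obtain d w c x where "legal d w c x" "1 \<le> d" "shows_state w c x (X t)"
      unfolding reached_def by blast
    from switchable_network[OF this] show False
      using stable by (simp add: stable_coloring_def)
  qed
  ultimately show ?thesis
    by blast
qed

end

lemma ex_slow_network:
  assumes "0 < K"
  shows "\<exists>(G :: nat pair_pre_digraph) col. pair_graph G \<and> 3 ^ K \<le> card (pverts G)
    \<and> card (pverts G) \<le> 82 * K * 3 ^ K
    \<and> (\<forall>X. execution G (free_rule G) col X \<longrightarrow> enat (6 * 9 ^ K) \<le> stabilization_time G X)"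
proof -
  interpret relay_graph K
    by standard (rule assms)
  define x0 where "x0 = (\<lambda>k::nat. if k = 0 then M 0 else 0)"
  define col where "col n = (if spin (\<lambda>_. 0) (\<lambda>_. 0) x0 (the_inv_into vertices label n) = 1
    then Black else White)" for n
  have "shows_state (\<lambda>_. 0) (\<lambda>_. 0) x0 col"
    by (simp add: shows_state_def col_def the_inv_into_f_f inj_label)
  then have "enat (6 * 9 ^ K) \<le> stabilization_time network X"
    if "execution network (free_rule network) col X" for X
    unfolding stabilization_time_def using execution_slow[OF that] unfolding x0_def
    by (auto intro!: INF_greatest)
  then show ?thesis
    using pair_graph_network card_vertices_le card_vertices_ge
    by (intro exI[of _ network] exI[of _ col]) (simp add: card_network)
qed

section \<open>Asymptotics in the number of nodes\<close>

lemma square_le_exponential: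
  assumes "0 < (\<epsilon>::real)"
  shows "real K ^ 2 \<le> 2 / (\<epsilon> * ln 3) ^ 2 * 3 powr (\<epsilon> * real K)"
proof -
  let ?y = "\<epsilon> * real K * ln 3"
  \<comment> \<open>The quadratic Taylor bound, where \<open>exp ?y\<close> is
    \<open>3 powr (\<epsilon> * real K)\<close>.\<close>
  have "?y ^ 2 / 2 \<le> exp ?y"
  proof -
    have "0 \<le> ?y"
      using assms by simp
    then show ?thesis
      using exp_lower_Taylor_quadratic[of ?y] by linarith
  qed
  then have "real K ^ 2 * (\<epsilon> * ln 3) ^ 2 \<le> 2 * 3 powr (\<epsilon> * real K)"
    by (simp add: powr_def power_mult_distrib mult_ac)
  moreover have "0 < (\<epsilon> * ln 3) ^ 2"
    using assms by simp
  ultimately show ?thesis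
    by (simp add: field_simps)
qed

text \<open>The factor \<open>K ^ 2\<close>, polylogarithmic in \<open>n\<close>, is absorbed by the
  gain \<open>3 powr (\<epsilon> * real K)\<close> from the exponent.\<close>

lemma size_powr_le:
  assumes "0 < \<epsilon>" "3 ^ K \<le> n" "n \<le> 82 * K * 3 ^ K"
  shows "real n powr (2 - \<epsilon>) \<le> 82 ^ 2 * (2 / (\<epsilon> * ln 3) ^ 2) * 9 ^ K"
proof -
  have n: "3 ^ K \<le> real n" "real n \<le> 82 * real K * 3 ^ K"
    using of_nat_mono[OF assms(2), where 'a = real] of_nat_mono[OF assms(3), where 'a = real]
    by simp_all
  have pos: "0 < real n"
    using n(1) by (rule less_le_trans[rotated]) simp
  \<comment> \<open>The upper bound on \<open>n\<close> enters the square and the lower bound the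
    negative power, whatever the sign of \<open>2 - \<epsilon>\<close>.\<close>
  have "real n powr (2 - \<epsilon>) = real n ^ 2 * real n powr - \<epsilon>"
    using pos powr_add[of "real n" 2 "- \<epsilon>"] by simp
  also have "\<dots> \<le> (82 * real K * 3 ^ K) ^ 2 * (3 ^ K) powr - \<epsilon>"
    using n assms(1) by (intro mult_mono power_mono powr_mono2') auto
  also have "\<dots> = 82 ^ 2 * 9 ^ K * real K ^ 2 * 3 powr - (\<epsilon> * real K)"
  proof -
    have "(3 ^ K) powr - \<epsilon> = (3::real) powr - (\<epsilon> * real K)"
      by (simp add: powr_realpow[symmetric] powr_powr mult_ac)
    moreover have "(3 ^ K) ^ 2 = (9::real) ^ K"
      by (simp flip: power_mult_distrib add: power2_eq_square)
    ultimately show ?thesis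
      by (simp add: power_mult_distrib mult_ac)
  qed
  also have "\<dots> \<le> 82 ^ 2 * 9 ^ K * (2 / (\<epsilon> * ln 3) ^ 2 * 3 powr (\<epsilon> * real K)) * 3 powr - (\<epsilon> * real K)"
    by (intro mult_mono square_le_exponential assms(1)) auto
  also have "\<dots> = 82 ^ 2 * (2 / (\<epsilon> * ln 3) ^ 2) * 9 ^ K"
    by (simp add: powr_minus)
  finally show ?thesis .
qed

theorem theorem4:
  fixes \<epsilon> :: real
  assumes "\<epsilon> > 0"
  shows "\<exists>c::real. c > 0 \<and>
    infinite {n::nat. \<exists>(G :: nat pair_pre_digraph) (col :: nat coloring).
      pair_graph G \<and> card (pverts G) = n \<and>
      (let bound = ereal (c * real n powr (2 - \<epsilon>)) in
        bound \<le> ereal_of_enat (benevolent_time G (sequential_rule G) col) \<and>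
        bound \<le> ereal_of_enat (benevolent_time G (independent_rule G) col) \<and>
        bound \<le> ereal_of_enat (benevolent_time G (free_rule G) col) \<and>
        bound \<le> ereal_of_enat (stabilization_time G (synchronous_execution G col)) \<and>
        (\<forall>X. possible_execution G (sequential_random_step G) col X \<longrightarrow>
              bound \<le> ereal_of_enat (stabilization_time G X)) \<and>
        (\<forall>p X. 0 < p \<and> p \<le> 1 \<and> possible_execution G (concurrent_random_step p G) col X \<longrightarrow>
              bound \<le> ereal_of_enat (stabilization_time G X)))}"
proof -
  define D where "D = 82 ^ 2 * (2 / (\<epsilon> * ln 3) ^ 2)"
  have D: "0 < D"
    using assms by (simp add: D_def)
  \<comment> \<open>Turns the size estimate \<open>D * 9 ^ K\<close> into the step bound
    \<open>6 * 9 ^ K\<close>.\<close>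
  define c where "c = 6 / D"
  show ?thesis
  proof (intro exI[of _ c] conjI)
    show "0 < c"
      using D by (simp add: c_def)
    show "infinite {n::nat. \<exists>(G :: nat pair_pre_digraph) (col :: nat coloring).
      pair_graph G \<and> card (pverts G) = n \<and>
      (let bound = ereal (c * real n powr (2 - \<epsilon>)) in
        bound \<le> ereal_of_enat (benevolent_time G (sequential_rule G) col) \<and>
        bound \<le> ereal_of_enat (benevolent_time G (independent_rule G) col) \<and>
        bound \<le> ereal_of_enat (benevolent_time G (free_rule G) col) \<and>
        bound \<le> ereal_of_enat (stabilization_time G (synchronous_execution G col)) \<and>
        (\<forall>X. possible_execution G (sequential_random_step G) col X \<longrightarrow>
              bound \<le> ereal_of_enat (stabilization_time G X)) \<and>
        (\<forall>p X. 0 < p \<and> p \<le> 1 \<and> possible_execution G (concurrent_random_step p G) col X \<longrightarrow>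
              bound \<le> ereal_of_enat (stabilization_time G X)))}" (is "infinite {n. ?P n}")
      unfolding infinite_nat_iff_unbounded
    proof
      fix m :: nat
      \<comment> \<open>\<open>K = m + 1\<close> is positive and gives
        \<open>n \<ge> 3 ^ (m + 1) > m\<close>.\<close>
      obtain G :: "nat pair_pre_digraph" and col where G: "pair_graph G"
          "3 ^ Suc m \<le> card (pverts G)" "card (pverts G) \<le> 82 * Suc m * 3 ^ Suc m"
        and slow: "\<And>X. execution G (free_rule G) col X \<Longrightarrow> enat (6 * 9 ^ Suc m) \<le> stabilization_time G X"
        using ex_slow_network[of "Suc m"] by blast
      have fin: "finite (pverts G)"
        using G(1) by (simp add: pair_graph_def pair_digraph_def pair_fin_digraph_def
            pair_fin_digraph_axioms_def)
      let ?n = "card (pverts G)"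
      have bound: "ereal (c * real ?n powr (2 - \<epsilon>)) \<le> ereal_of_enat e"
        if "enat (6 * 9 ^ Suc m) \<le> e" for e
      proof -
        have "c * real ?n powr (2 - \<epsilon>) \<le> c * (D * 9 ^ Suc m)"
          using size_powr_le[OF assms G(2,3)] D unfolding D_def[symmetric]
          by (intro mult_left_mono) (auto simp: c_def)
        also have "\<dots> = real (6 * 9 ^ Suc m)"
          using D by (simp add: c_def)
        finally have "ereal (c * real ?n powr (2 - \<epsilon>)) \<le> ereal_of_enat (enat (6 * 9 ^ Suc m))"
          by simp
        also have "\<dots> \<le> ereal_of_enat e"
          using that by (simp only: ereal_of_enat_le_iff)
        finally show ?thesis .
      qed
      \<comment> \<open>Every model restricts the free one. Only unstable colorings are compared,
        because the sequential random distribution is meaningful only there.\<close>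
      have free: "enat (6 * 9 ^ Suc m) \<le> stabilization_time G X"
        if "\<And>col. \<not> stable_coloring G col \<Longrightarrow> R col \<subseteq> free_rule G col" "execution G R col X" for R X
        using slow execution_mono[OF that] by blast
      have "?P ?n"
        unfolding Let_def
      proof (intro exI conjI allI impI)
        show "ereal (c * real ?n powr (2 - \<epsilon>)) \<le> ereal_of_enat (benevolent_time G (sequential_rule G) col)"
          by (intro bound benevolent_time_ge free[of "sequential_rule G"])
            (auto simp: sequential_rule_def free_rule_def)
        show "ereal (c * real ?n powr (2 - \<epsilon>)) \<le> ereal_of_enat (benevolent_time G (independent_rule G) col)"
          by (intro bound benevolent_time_ge free[of "independent_rule G"])
            (auto simp: independent_rule_def free_rule_def)
        show "ereal (c * real ?n powr (2 - \<epsilon>)) \<le> ereal_of_enat (benevolent_time G (free_rule G) col)"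
          by (intro bound benevolent_time_ge slow)
        show "ereal (c * real ?n powr (2 - \<epsilon>))
            \<le> ereal_of_enat (stabilization_time G (synchronous_execution G col))"
          by (intro bound slow synchronous_execution_free)
        show "ereal (c * real ?n powr (2 - \<epsilon>)) \<le> ereal_of_enat (stabilization_time G X)"
          if "possible_execution G (sequential_random_step G) col X" for X
          using that unfolding possible_execution_def
          by (intro bound, elim free[rotated])
            (auto simp: sequential_random_step_def free_rule_def stable_coloring_def
              set_pmf_of_set finite_switchable[OF fin])
        show "ereal (c * real ?n powr (2 - \<epsilon>)) \<le> ereal_of_enat (stabilization_time G X)"
          if "0 < p \<and> p \<le> 1 \<and> possible_execution G (concurrent_random_step p G) col X" for p X
        proof -
          have "execution G (\<lambda>col'. set_pmf (concurrent_random_step p G col')) col X"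
            using that by (simp add: possible_execution_def)
          then show ?thesis
            by (intro bound, elim free[rotated])
              (auto simp: concurrent_random_step_def free_rule_def)
        qed
      qed (use G in auto)
      moreover have "m < ?n"
        using power_gt_expt[of 3 "Suc m"] G(2) by simp
      ultimately show "\<exists>n>m. n \<in> {n. ?P n}"
        by blast
    qed
  qed
qed

end
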